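(* Let $k$ be a positive integer and let $p$ be a prime number such that $p\equiv 2\pmod 3$. Let $r$ be a non-negative integer such that $p$ divides $3r+2$. Then for every integer $n\ge 0$, $$B_5\left(p^{k+1}n+pr+\frac{2p-1}{3}\right)\equiv(-p^3)\cdot B_5\left(p^{k-1}n+\frac{3r+2-p}{3p}\right)\pmod 5.$$
   Context: A partition is called $5$-regular if none of its parts is divisible by $5$. $B_5(n)$ denotes the number of ordered pairs $(\lambda,\mu)$ of $5$-regular partitions such that the sum of all parts of $\lambda$ and $\mu$ equals $n$ (so $B_5(0)=1$); equivalently $\sum_{n\ge 0}B_5(n)q^n=\prod_{k\ge1}\frac{(1-q^{5k})^2}{(1-q^k)^2}$. *)

theory Defs
  imports "HOL-Library.Multiset" "HOL-Number_Theory.Number_Theory"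
begin

text \<open>A partition is the multiset of its parts, which are positive integers; its size is the
  sum \<open>\<Sum>\<^sub># M\<close> of the parts with multiplicity.\<close>

definition is_partition :: "nat multiset \<Rightarrow> bool" where
  "is_partition M \<longleftrightarrow> (\<forall>x\<in>#M. x > 0)"

definition regular_partition :: "nat \<Rightarrow> nat multiset \<Rightarrow> bool" where
  "regular_partition l M \<longleftrightarrow> is_partition M \<and> (\<forall>x\<in>#M. \<not> l dvd x)"

definition regular_bipartitions :: "nat \<Rightarrow> nat \<Rightarrow> (nat multiset \<times> nat multiset) set" where
  "regular_bipartitions l n =
     {(M, N). regular_partition l M \<and> regular_partition l N \<and> \<Sum>\<^sub># M + \<Sum>\<^sub># N = n}"

definition B\<^sub>5 :: "nat \<Rightarrow> nat" where
  "B\<^sub>5 n = card (regular_bipartitions 5 n)"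

lemma size_le_sum_mset_partition:
  assumes "is_partition M"
  shows "size M \<le> \<Sum>\<^sub># M"
  using assms by (induction M) (auto simp: is_partition_def)

lemma finite_regular_bipartitions: "finite (regular_bipartitions l n)"
proof -
  define S where "S = {M :: nat multiset. set_mset M \<subseteq> {..n} \<and> size M \<le> n}"
  have "S \<subseteq> mset ` {xs. set xs \<subseteq> {..n} \<and> length xs \<le> n}"
  proof
    fix M assume "M \<in> S"
    moreover obtain xs where "M = mset xs" by (metis ex_mset)
    ultimately show "M \<in> mset ` {xs. set xs \<subseteq> {..n} \<and> length xs \<le> n}"
      by (auto simp: S_def)
  qed
  then have "finite S"
    by (rule finite_subset) (simp add: finite_lists_length_le)
  moreover have "M \<in> S" if "is_partition M" "\<Sum>\<^sub># M \<le> n" for M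
  proof -
    have "x \<le> n" if "x \<in># M" for x
      using sum_mset.remove[OF that] \<open>\<Sum>\<^sub># M \<le> n\<close> by simp
    then show ?thesis
      using size_le_sum_mset_partition[OF that(1)] that(2) by (auto simp: S_def)
  qed
  then have "regular_bipartitions l n \<subseteq> S \<times> S"
    by (auto simp: regular_bipartitions_def regular_partition_def)
  ultimately show ?thesis
    using finite_subset by blast
qed

lemma B5_0: "B\<^sub>5 0 = 1"
proof -
  have "M = {#}" if "is_partition M" "\<Sum>\<^sub># M = 0" for M
    using size_le_sum_mset_partition[OF that(1)] that(2) by simp
  then have "regular_bipartitions 5 0 = {({#}, {#})}"
    by (auto simp: regular_bipartitions_def regular_partition_def is_partition_def)
  then show ?thesis by (simp add: B\<^sub>5_def)
qed

text \<open>For \<open>p\<close> prime with \<open>p \<equiv> 2 (mod 3)\<close> and \<open>p\<close> dividing \<open>3 * r + 2\<close>, the truncating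
  operations on \<^typ>\<open>nat\<close> in \<open>(2 * p - 1) div 3\<close> and \<open>(3 * r + 2 - p) div (3 * p)\<close> are
  exact.\<close>

lemma index_shifts_exact:
  fixes p r :: nat
  assumes "prime p" "[p = 2] (mod 3)" "p dvd 3 * r + 2"
  shows "real ((2 * p - 1) div 3) = (2 * real p - 1) / 3"
    and "real ((3 * r + 2 - p) div (3 * p)) = (3 * real r + 2 - real p) / (3 * real p)"
proof -
  have p3: "p mod 3 = 2" using assms(2) by (simp add: cong_def)
  have p0: "p > 0" using assms(1) by (simp add: prime_gt_0_nat)
  obtain j where j: "p = 3 * j + 2" using p3 by (metis mult_div_mod_eq)
  then show "real ((2 * p - 1) div 3) = (2 * real p - 1) / 3" by simp
  obtain m where m: "3 * r + 2 = p * m" using assms(3) by (elim dvdE)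
  have "(p * m) mod 3 = 2" using m by presburger
  then have "(2 * m) mod 3 = 2" using p3 by (metis mod_mult_left_eq)
  then have "m mod 3 = 1" by presburger
  then obtain i where i: "m = 3 * i + 1" by (metis mult_div_mod_eq)
  have *: "3 * r + 2 = 3 * p * i + p" using m i by (simp add: algebra_simps)
  then have "(3 * r + 2 - p) div (3 * p) = i" using p0 by simp
  moreover have "3 * real r + 2 = 3 * real p * real i + real p"
    using arg_cong[OF *, of real] by simp
  ultimately show "real ((3 * r + 2 - p) div (3 * p)) = (3 * real r + 2 - real p) / (3 * real p)"
    using p0 by simp
qed

end

theory Submission imports Defs "HOL-Computational_Algebra.Formal_Power_Series" begin

text \<open>
  Write \<open>E = \<Prod>\<^bsub>i\<ge>1\<^esub> (1 - q\<^bsup>i\<^esup>)\<close>. Since \<open>1 - q\<^bsup>5i\<^esup> \<equiv> (1 - q\<^bsup>i\<^esup>)\<^bsup>5\<^esup>\<close> modulo 5, the generating function of \<open>B\<^sub>5\<close>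
  is congruent to \<open>E\<^bsup>10\<^esup> / E\<^bsup>2\<^esup> = E\<^bsup>8\<^esup>\<close>. Macdonald's identity for the root system \<open>A\<^sub>2\<close> reads
  \<open>2 E\<^bsup>8\<^esup> = - \<Sum>\<^bsub>a,b\<^esub> \<chi>(a + b) a\<^bsup>2\<^esup> b q\<^bsup>(a\<^sup>2 - a b + b\<^sup>2 - 1)/3\<^esup>\<close>, with \<open>\<chi>\<close> the nontrivial character modulo 3.
  A prime \<open>p \<equiv> 2\<close> modulo 3 is inert in the Eisenstein integers, so it divides \<open>a\<^sup>2 - a b + b\<^sup>2\<close> only if it
  divides both \<open>a\<close> and \<open>b\<close>; replacing \<open>(a, b)\<close> by \<open>(p a, p b)\<close> multiplies the weight by \<open>- p\<^bsup>3\<^esup>\<close>.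

  To prove Macdonald's identity, expand
  \<open>\<Sum>\<^bsub>i,j,k\<^esub> (-1)\<^bsup>i+j+k\<^esup> (i - k)\<^bsup>2\<^esup> (j - k) q\<^bsup>T(i) + T(j) + T(k)\<^esup>\<close> with \<open>T(i) = i (i - 1) / 2\<close> in two ways. Multiplying out
  the weight, Jacobi's identity for \<open>E\<^bsup>3\<^esup>\<close> gives \<open>2 E\<^bsup>9\<^esup>\<close>. For fixed \<open>a = i - k\<close> and \<open>b = j - k\<close>,
  completing the square in \<open>k\<close> turns the inner sum into 0 or into a power of \<open>q\<close> times Euler's pentagonal
  series for \<open>E\<close>.
\<close>

unbundle fps_syntax

abbreviation X :: "int fps" where "X \<equiv> fps_X"

subsection \<open>Truncation of formal power series\<close>

lemma X_power_dvd_iff: "X ^ m dvd f \<longleftrightarrow> (\<forall>i<m. f $ i = 0)"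
proof
  assume "X ^ m dvd f"
  then obtain g where "f = X ^ m * g" by (elim dvdE)
  then show "\<forall>i<m. f $ i = 0" by (simp add: fps_X_power_mult_nth)
next
  assume *: "\<forall>i<m. f $ i = 0"
  have "f = X ^ m * fps_shift m f"
    by (rule fps_ext) (use * in \<open>auto simp: fps_X_power_mult_nth\<close>)
  then show "X ^ m dvd f" by (rule dvdI)
qed

text \<open>Identities between infinite products and series are obtained through this lemma: finite
  truncations are compared modulo every power \<open>X ^ Suc m\<close>.\<close>

lemma eq_if_cong_all_X_powers:
  assumes "\<And>m. X ^ Suc m dvd f - g"
  shows "f = g"
proof (rule fps_ext)
  fix n show "f $ n = g $ n" using assms[of n] by (simp add: X_power_dvd_iff del: power_Suc)
qed

lemma invertible_if_constant_1:
  fixes f :: "int fps"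
  assumes "f $ 0 = 1"
  obtains g where "f * g = 1"
proof -
  have "f * fps_right_inverse f 1 = 1"
    by (rule fps_right_inverse) (use assms in simp)
  then show ?thesis using that by blast
qed

text \<open>A series with constant term 1 is a unit, so it cancels from divisibility by any
  \<open>d\<close>. Both powers of \<open>X\<close> and the integer 5 occur as \<open>d\<close>
  below.\<close>

lemma dvd_cancel_constant_1:
  fixes f h d :: "int fps"
  assumes "f $ 0 = 1" "d dvd f * h"
  shows "d dvd h"
proof -
  obtain g where "f * g = 1" using invertible_if_constant_1[OF assms(1)] .
  then have "h = g * (f * h)" by (metis mult.assoc mult.commute mult.right_neutral)
  then show ?thesis using assms(2) by (metis dvd_mult)
qed

subsection \<open>Euler's product\<close>

definition poch :: "nat \<Rightarrow> int fps" where
  "poch n = (\<Prod>i=1..n. 1 - X ^ i)"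

text \<open>The infinite product without a limit: factors beyond the \<open>n\<close>-th do not
  affect coefficient \<open>n\<close>, so the diagonal coefficients of the partial products
  suffice.\<close>

definition euler :: "int fps" where
  "euler = Abs_fps (\<lambda>n. poch n $ n)"

lemma poch_0 [simp]: "poch 0 = 1"
  by (simp add: poch_def)

lemma poch_Suc: "poch (Suc n) = poch n * (1 - X ^ Suc n)"
  by (simp add: poch_def)

lemma poch_nth_0 [simp]: "poch n $ 0 = 1"
  by (induction n) (simp_all add: poch_Suc)

lemma euler_nth_0 [simp]: "euler $ 0 = 1"
  by (simp add: euler_def)

lemma poch_cong: "n \<le> m \<Longrightarrow> X ^ Suc n dvd poch m - poch n"
proof (induction m rule: dec_induct)
  case (step m)
  have "poch (Suc m) - poch n = (poch m - poch n) - X ^ Suc m * poch m"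
    by (simp add: poch_Suc algebra_simps)
  moreover have "X ^ Suc n dvd X ^ Suc m * poch m"
    using step.hyps by (intro dvd_mult2 le_imp_power_dvd) simp
  ultimately show ?case using step.IH by (metis dvd_diff)
qed simp

lemma euler_cong_poch:
  assumes "m \<le> n"
  shows "X ^ Suc m dvd euler - poch n"
  unfolding X_power_dvd_iff
proof (intro allI impI)
  fix i assume "i < Suc m"
  then show "(euler - poch n) $ i = 0"
    using poch_cong[of i n] assms by (simp add: euler_def X_power_dvd_iff del: power_Suc)
qed

section \<open>Congruences written as divisibility of differences\<close>

lemma dvd_diff_mult:
  fixes d :: "'a::comm_ring_1"
  assumes "d dvd a - a'" "d dvd b - b'"
  shows "d dvd a * b - a' * b'"
proof -
  have "a * b - a' * b' = (a - a') * b + a' * (b - b')" by (simp add: algebra_simps)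
  then show ?thesis using assms by (metis dvd_add dvd_mult dvd_mult2)
qed

lemma dvd_diff_trans:
  fixes d :: "'a::comm_ring_1"
  assumes "d dvd a - b" "d dvd b - c"
  shows "d dvd a - c"
  using dvd_add[OF assms] by simp

lemma dvd_diff_sym:
  fixes d :: "'a::comm_ring_1"
  shows "d dvd a - b \<Longrightarrow> d dvd b - a"
  by (subst dvd_minus_iff[symmetric]) simp

lemma dvd_diff_power:
  fixes d :: "'a::comm_ring_1"
  shows "d dvd a - b \<Longrightarrow> d dvd a ^ n - b ^ n"
  by (induction n) (auto intro: dvd_diff_mult)

lemma dvd_diff_sum:
  fixes d :: "'a::comm_ring_1"
  assumes "\<And>x. x \<in> A \<Longrightarrow> d dvd f x - g x"
  shows "d dvd sum f A - sum g A"
  unfolding sum_subtractf[symmetric] using assms by (intro dvd_sum)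

subsection \<open>Series indexed by arbitrary sets\<close>

text \<open>This encodes the sum of \<open>c x * q ^ e x\<close> over \<open>x\<close> in
  \<open>A\<close>. Exponents are integers so that quadratic forms can be used directly. Negative
  exponents are dropped and an infinite fibre contributes the default sum 0; \<open>graded\<close>
  rules out both.\<close>

definition gseries :: "'a set \<Rightarrow> ('a \<Rightarrow> int) \<Rightarrow> ('a \<Rightarrow> int) \<Rightarrow> int fps" where
  "gseries A e c = Abs_fps (\<lambda>n. \<Sum>x | x \<in> A \<and> e x = int n. c x)"

definition graded :: "'a set \<Rightarrow> ('a \<Rightarrow> int) \<Rightarrow> bool" where
  "graded A e \<longleftrightarrow> (\<forall>x\<in>A. e x \<ge> 0) \<and> (\<forall>n. finite {x \<in> A. e x = int n})"

lemma gseries_nth: "gseries A e c $ n = (\<Sum>x | x \<in> A \<and> e x = int n. c x)"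
  by (simp add: gseries_def)

lemma gseries_cong:
  assumes "\<And>x. x \<in> A \<Longrightarrow> e x = e' x" "\<And>x. x \<in> A \<Longrightarrow> c x = c' x"
  shows "gseries A e c = gseries A e' c'"
  by (rule fps_ext) (use assms in \<open>auto simp: gseries_nth intro!: sum.cong\<close>)

lemma gseries_add: "gseries A e (\<lambda>x. c x + d x) = gseries A e c + gseries A e d"
  by (rule fps_ext) (simp add: gseries_nth sum.distrib)

lemma gseries_diff: "gseries A e (\<lambda>x. c x - d x) = gseries A e c - gseries A e d"
  by (rule fps_ext) (simp add: gseries_nth sum_subtractf)

lemma gseries_minus: "gseries A e (\<lambda>x. - c x) = - gseries A e c"
  by (rule fps_ext) (simp add: gseries_nth sum_negf)

lemma gseries_reindex:
  assumes "bij_betw h A B"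
  shows "gseries B e c = gseries A (\<lambda>x. e (h x)) (\<lambda>x. c (h x))"
proof (rule fps_ext)
  fix n
  have "bij_betw h {x \<in> A. e (h x) = int n} {y \<in> B. e y = int n}"
    using assms by (auto simp: bij_betw_def inj_on_def)
  from sum.reindex_bij_betw[OF this, of c]
  show "gseries B e c $ n = gseries A (\<lambda>x. e (h x)) (\<lambda>x. c (h x)) $ n"
    by (simp add: gseries_nth)
qed

lemma gseries_Un:
  assumes "graded (A \<union> B) e" "A \<inter> B = {}"
  shows "gseries (A \<union> B) e c = gseries A e c + gseries B e c"
proof (rule fps_ext)
  fix n
  have "{x \<in> A \<union> B. e x = int n} = {x \<in> A. e x = int n} \<union> {x \<in> B. e x = int n}" by auto
  moreover have "finite {x \<in> A \<union> B. e x = int n}" using assms(1) by (simp add: graded_def)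
  ultimately show "gseries (A \<union> B) e c $ n = (gseries A e c + gseries B e c) $ n"
    using assms(2) by (simp add: gseries_nth) (subst sum.union_disjoint, auto)
qed

lemma gseries_eq_0_if_sign_reversing:
  assumes "bij_betw h A A" "\<And>x. x \<in> A \<Longrightarrow> e (h x) = e x" "\<And>x. x \<in> A \<Longrightarrow> c (h x) = - c x"
  shows "gseries A e c = 0"
proof -
  have "gseries A e c = gseries A (\<lambda>x. e (h x)) (\<lambda>x. c (h x))"
    by (rule gseries_reindex[OF assms(1)])
  also have "\<dots> = gseries A e (\<lambda>x. - c x)"
    using assms(2,3) by (rule gseries_cong)
  finally have eq: "gseries A e c = - gseries A e c" by (simp add: gseries_minus)
  show ?thesis
  proof (rule fps_ext)
    fix n show "gseries A e c $ n = 0 $ n"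
      using arg_cong[OF eq, of "\<lambda>f. f $ n"] by simp
  qed
qed

lemma times_fibre:
  assumes "\<forall>x\<in>A. e x \<ge> 0" "\<forall>x\<in>B. e' x \<ge> 0"
  shows "{z \<in> A \<times> B. e (fst z) + e' (snd z) = int n} =
    (\<Union>i\<in>{0..n}. {x \<in> A. e x = int i} \<times> {y \<in> B. e' y = int (n - i)})" (is "?L = ?R")
proof
  show "?L \<subseteq> ?R"
  proof
    fix z assume z: "z \<in> ?L"
    then have "e (fst z) \<ge> 0" "e' (snd z) \<ge> 0" using assms by auto
    with z show "z \<in> ?R"
      by (intro UN_I[of "nat (e (fst z))"]) (auto simp: mem_Times_iff)
  qed
  show "?R \<subseteq> ?L" by auto
qed

lemma graded_times:
  assumes "graded A e" "graded B e'"
  shows "graded (A \<times> B) (\<lambda>z. e (fst z) + e' (snd z))"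
  unfolding graded_def
proof (intro conjI allI ballI)
  fix n
  have "{z \<in> A \<times> B. e (fst z) + e' (snd z) = int n} =
    (\<Union>i\<in>{0..n}. {x \<in> A. e x = int i} \<times> {y \<in> B. e' y = int (n - i)})"
    by (rule times_fibre) (use assms in \<open>auto simp: graded_def\<close>)
  moreover have "finite {x \<in> A. e x = int i}" "finite {y \<in> B. e' y = int i}" for i
    using assms by (auto simp: graded_def)
  ultimately show "finite {z \<in> A \<times> B. e (fst z) + e' (snd z) = int n}"
    by (simp add: finite_cartesian_product del: of_nat_diff)
qed (use assms in \<open>auto simp: graded_def\<close>)

lemma gseries_times:
  assumes "graded A e" "graded B e'"
  shows "gseries (A \<times> B) (\<lambda>z. e (fst z) + e' (snd z)) (\<lambda>z. c (fst z) * d (snd z)) =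
    gseries A e c * gseries B e' d"
proof (rule fps_ext)
  fix n
  let ?F = "\<lambda>i. {x \<in> A. e x = int i}" and ?G = "\<lambda>i. {y \<in> B. e' y = int i}"
  have fin: "finite (?F i)" "finite (?G i)" for i using assms by (auto simp: graded_def)
  have fib: "{z \<in> A \<times> B. e (fst z) + e' (snd z) = int n} = (\<Union>i\<in>{0..n}. ?F i \<times> ?G (n - i))"
    by (rule times_fibre) (use assms in \<open>auto simp: graded_def\<close>)
  have "(\<Sum>z\<in>{z \<in> A \<times> B. e (fst z) + e' (snd z) = int n}. c (fst z) * d (snd z)) =
      (\<Sum>i=0..n. \<Sum>z\<in>?F i \<times> ?G (n - i). c (fst z) * d (snd z))"
    unfolding fib by (rule sum.UNION_disjoint) (use fin in \<open>auto simp del: of_nat_diff\<close>)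
  also have "\<dots> = (\<Sum>i=0..n. sum c (?F i) * sum d (?G (n - i)))"
    by (intro sum.cong refl) (simp add: sum_product sum.cartesian_product case_prod_beta)
  finally show "gseries (A \<times> B) (\<lambda>z. e (fst z) + e' (snd z)) (\<lambda>z. c (fst z) * d (snd z)) $ n =
      (gseries A e c * gseries B e' d) $ n"
    by (simp add: gseries_nth fps_mult_nth)
qed

text \<open>Passage to a polynomial: \<open>F\<close> has to contain all indices of exponent at most
  \<open>m\<close>, and may contain more, since the surplus terms vanish modulo
  \<open>X ^ Suc m\<close>.\<close>

lemma gseries_cong_sum:
  assumes "finite F" "F \<subseteq> A" "\<And>x. x \<in> A \<Longrightarrow> e x \<le> int m \<Longrightarrow> x \<in> F"
    "\<And>x. x \<in> F \<Longrightarrow> e x \<ge> 0"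
  shows "X ^ Suc m dvd gseries A e c - (\<Sum>x\<in>F. of_int (c x) * X ^ nat (e x))"
  unfolding X_power_dvd_iff
proof (intro allI impI)
  fix i assume i: "i < Suc m"
  have "(\<Sum>x\<in>F. of_int (c x) * X ^ nat (e x)) $ i = (\<Sum>x\<in>F. if e x = int i then c x else 0)"
    unfolding fps_sum_nth
  proof (rule sum.cong[OF refl])
    fix x assume "x \<in> F"
    then have "e x \<ge> 0" by (rule assms(4))
    then have "i = nat (e x) \<longleftrightarrow> e x = int i" by auto
    then show "(of_int (c x) * X ^ nat (e x)) $ i = (if e x = int i then c x else 0)"
      by (simp add: fps_mult_of_int_nth)
  qed
  also have "\<dots> = (\<Sum>x\<in>{x \<in> F. e x = int i}. c x)"
    using assms(1) by (simp add: sum.inter_filter)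
  also have "{x \<in> F. e x = int i} = {x \<in> A. e x = int i}"
    using assms(2,3) i by auto
  finally show "(gseries A e c - (\<Sum>x\<in>F. of_int (c x) * X ^ nat (e x))) $ i = 0"
    by (simp add: gseries_nth)
qed

subsection \<open>The pentagonal number theorem\<close>

definition sgnp :: "int \<Rightarrow> int" where
  "sgnp i = (if even i then 1 else -1)"

definition tri :: "int \<Rightarrow> int" where
  "tri i = i * (i - 1) div 2"

definition pent :: "int \<Rightarrow> int" where
  "pent i = i * (3 * i - 1) div 2"

lemma two_tri: "2 * tri i = i * (i - 1)"
  by (simp add: tri_def)

lemma two_pent: "2 * pent i = i * (3 * i - 1)"
  by (simp add: pent_def)

lemma tri_nonneg: "tri i \<ge> 0"
proof -
  have "0 \<le> i * (i - 1)"
    by (cases "i \<ge> 1") (auto intro: mult_nonneg_nonneg mult_nonpos_nonpos)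
  then show ?thesis using two_tri[of i] by linarith
qed

lemma tri_add_1: "tri (i + 1) = tri i + i"
proof -
  have "2 * tri (i + 1) = 2 * (tri i + i)"
    unfolding two_tri distrib_left by (simp add: algebra_simps)
  then show ?thesis by simp
qed

text \<open>Both bounds come from nonnegativity of \<open>tri\<close> at the neighbours
  \<open>i - 1\<close> and \<open>i + 1\<close>. They make the fibres of \<open>tri\<close>
  finite.\<close>

lemma tri_lower_bounds: "i \<le> tri i + 1" "- i \<le> tri i"
  using tri_nonneg[of "i - 1"] tri_nonneg[of "i + 1"] tri_add_1[of "i - 1"] tri_add_1[of i]
  by simp_all

lemma pent_ge_abs: "\<bar>i\<bar> \<le> pent i"
proof -
  have "0 \<le> \<bar>i\<bar> * (\<bar>i\<bar> - 1)"
    by (cases "i = 0") (auto intro: mult_nonneg_nonneg)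
  then have "2 * \<bar>i\<bar> \<le> 2 * pent i"
    unfolding two_pent by (cases "i \<ge> 0") (auto simp: algebra_simps)
  then show ?thesis by simp
qed

lemma graded_tri: "graded UNIV tri"
  unfolding graded_def
proof (intro conjI ballI allI tri_nonneg)
  fix n
  have "{i \<in> UNIV. tri i = int n} \<subseteq> {- int n - 1..int n + 1}"
  proof
    fix i assume "i \<in> {i \<in> UNIV. tri i = int n}"
    then show "i \<in> {- int n - 1..int n + 1}" using tri_lower_bounds[of i] by auto
  qed
  then show "finite {i \<in> UNIV. tri i = int n}" by (rule finite_subset) simp
qed

lemma graded_pent: "graded UNIV pent"
  unfolding graded_def
proof (intro conjI ballI allI)
  fix n
  have "{i \<in> UNIV. pent i = int n} \<subseteq> {- int n..int n}"
  proof
    fix i assume "i \<in> {i \<in> UNIV. pent i = int n}"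
    then show "i \<in> {- int n..int n}" using pent_ge_abs[of i] by auto
  qed
  then show "finite {i \<in> UNIV. pent i = int n}" by (rule finite_subset) simp
  fix i show "pent i \<ge> 0" using pent_ge_abs[of i] by linarith
qed

text \<open>Shanks' finite form of the pentagonal series. The product over \<open>{s<..n}\<close> is
  the quotient of \<open>poch n\<close> by \<open>poch s\<close>, written without division.\<close>

definition shanks :: "nat \<Rightarrow> int fps" where
  "shanks n = (\<Sum>s\<le>n. (-1) ^ s * (\<Prod>i\<in>{s<..n}. 1 - X ^ i) * X ^ (s * n + s * (s + 1) div 2))"

lemma tri_exponents:
  "n * n + n * (n + 1) div 2 = (n * (3 * n + 1) div 2 :: nat)"
  "Suc n * Suc n + n * (n + 1) div 2 = (Suc n * (3 * Suc n - 1) div 2 :: nat)"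
proof -
  have "even (n * (n + 1))" by simp
  then obtain t where t: "n * (n + 1) = 2 * t" by blast
  have "n * (3 * n + 1) = 2 * (n * n + t)" using t by (simp add: algebra_simps)
  then show "n * n + n * (n + 1) div 2 = (n * (3 * n + 1) div 2 :: nat)" using t by simp
  have "Suc n * (3 * Suc n - 1) = 2 * (Suc n * Suc n + t)" using t by (simp add: algebra_simps)
  then show "Suc n * Suc n + n * (n + 1) div 2 = (Suc n * (3 * Suc n - 1) div 2 :: nat)"
    using t by (metis nonzero_mult_div_cancel_left zero_neq_numeral)
qed

text \<open>The changes of the summands \<open>s \<le> n\<close> telescope to one pentagonal power;
  the new summand \<open>s = Suc n\<close> is the other.\<close>

lemma shanks_Suc:
  "shanks (Suc n) = shanks n + (-1) ^ Suc n *
    (X ^ (Suc n * (3 * Suc n - 1) div 2) + X ^ (Suc n * (3 * Suc n + 1) div 2))"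
proof -
  define Q where "Q s = (\<Prod>i\<in>{s<..n}. 1 - X ^ i)" for s
  \<comment> \<open>\<open>- U m\<close> is the partial sum of the changes up to
    \<open>s = m\<close>. At \<open>m = n\<close> the product \<open>Q n\<close> is empty, so only a
    signed power of \<open>X\<close> remains.\<close>
  define U where "U s = (-1) ^ s * Q s * X ^ (Suc s * Suc n + s * (s + 1) div 2)" for s
  have Q_rec: "Q s = (1 - X ^ Suc s) * Q (Suc s)" if "s < n" for s
  proof -
    have "{s<..n} = insert (Suc s) {Suc s<..n}" using that by auto
    then show ?thesis by (simp add: Q_def)
  qed
  have tele: "(\<Sum>s\<le>m. (-1) ^ s * Q s * (1 - X ^ Suc n) * X ^ (s * Suc n + s * (s + 1) div 2)
      - (-1) ^ s * Q s * X ^ (s * n + s * (s + 1) div 2)) = - U m" if "m \<le> n" for m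
    using that
  proof (induction m)
    case 0
    then show ?case by (simp add: U_def algebra_simps)
  next
    case (Suc m)
    have T: "Suc m * (Suc m + 1) div 2 = m * (m + 1) div 2 + Suc m"
    proof -
      have "Suc m * (Suc m + 1) = m * (m + 1) + 2 * Suc m" by simp
      then show ?thesis by simp
    qed
    define a where "a = Suc m * n + m * (m + 1) div 2"
    define q where "q = Q (Suc m)"
    have e: "Suc m * Suc n + m * (m + 1) div 2 = a + Suc m"
      "Suc m * Suc n + Suc m * (Suc m + 1) div 2 = a + 2 * Suc m"
      "Suc m * n + Suc m * (Suc m + 1) div 2 = a + Suc m"
      "Suc (Suc m) * Suc n + Suc m * (Suc m + 1) div 2 = a + 2 * Suc m + Suc n"
      unfolding T a_def by simp_all
    have qm: "Q m = (1 - X ^ Suc m) * q" using Suc.prems Q_rec[of m] by (simp add: q_def)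
    have "(\<Sum>s\<le>Suc m. (-1) ^ s * Q s * (1 - X ^ Suc n) * X ^ (s * Suc n + s * (s + 1) div 2)
      - (-1) ^ s * Q s * X ^ (s * n + s * (s + 1) div 2)) =
      - U m + ((-1) ^ Suc m * q * (1 - X ^ Suc n) * X ^ (a + 2 * Suc m)
      - (-1) ^ Suc m * q * X ^ (a + Suc m))"
      using Suc by (simp only: sum.atMost_Suc e q_def Suc_leD)
    also have "\<dots> = - U (Suc m)"
    proof -
      \<comment> \<open>With the powers as atoms, the step becomes a polynomial identity in
        \<open>x\<close>, \<open>y\<close> and \<open>z\<close>.\<close>
      define x y z where "x = X ^ Suc m" and "y = X ^ Suc n" and "z = X ^ a"
      have p: "X ^ (a + Suc m) = z * x" "X ^ (a + 2 * Suc m) = z * x * x"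
        "X ^ (a + 2 * Suc m + Suc n) = z * x * x * y" "(-1 :: int fps) ^ Suc m = - ((-1) ^ m)"
        unfolding x_def y_def z_def mult_2 power_add by (simp_all add: mult.assoc)
      show ?thesis
        unfolding U_def e qm q_def[symmetric] p x_def[symmetric] y_def[symmetric]
        by (simp add: algebra_simps)
    qed
    finally show ?case .
  qed
  have split: "(\<Prod>i\<in>{s<..Suc n}. 1 - X ^ i) = Q s * (1 - X ^ Suc n)" if "s \<le> n" for s
  proof -
    have "{s<..Suc n} = insert (Suc n) {s<..n}" using that by auto
    then show ?thesis by (simp add: Q_def mult.commute)
  qed
  have "shanks (Suc n) - shanks n =
    (\<Sum>s\<le>n. (-1) ^ s * Q s * (1 - X ^ Suc n) * X ^ (s * Suc n + s * (s + 1) div 2)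
      - (-1) ^ s * Q s * X ^ (s * n + s * (s + 1) div 2))
    + (-1) ^ Suc n * X ^ (Suc n * Suc n + Suc n * (Suc n + 1) div 2)"
    unfolding shanks_def sum.atMost_Suc sum_subtractf
    by (simp add: split Q_def[symmetric] mult.assoc del: power_Suc mult_Suc mult_Suc_right)
  also have "\<dots> = - U n + (-1) ^ Suc n * X ^ (Suc n * Suc n + Suc n * (Suc n + 1) div 2)"
    by (subst tele) simp_all
  also have "U n = (-1) ^ n * X ^ (Suc n * (3 * Suc n - 1) div 2)"
    unfolding U_def tri_exponents by (simp add: Q_def)
  also have "Suc n * Suc n + Suc n * (Suc n + 1) div 2 = Suc n * (3 * Suc n + 1) div 2"
    by (rule tri_exponents)
  finally show ?thesis by (simp add: algebra_simps)
qed

lemma nat_pent: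
  "nat (pent (int n)) = n * (3 * n - 1) div 2"
  "nat (pent (- int n)) = n * (3 * n + 1) div 2"
proof -
  have "int (n * (3 * n - 1)) = int n * (3 * int n - 1)"
    by (cases n) (simp_all add: algebra_simps)
  then have "pent (int n) = int (n * (3 * n - 1) div 2)"
    unfolding pent_def by (metis of_nat_numeral zdiv_int)
  then show "nat (pent (int n)) = n * (3 * n - 1) div 2" by simp
  have "int (n * (3 * n + 1)) = - int n * (3 * (- int n) - 1)"
    by (simp add: algebra_simps)
  then have "pent (- int n) = int (n * (3 * n + 1) div 2)"
    unfolding pent_def by (metis of_nat_numeral zdiv_int)
  then show "nat (pent (- int n)) = n * (3 * n + 1) div 2" by simp
qed

lemma of_int_sgnp_int: "of_int (sgnp (int n)) = ((-1) ^ n :: int fps)"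
  "of_int (sgnp (- int n)) = ((-1) ^ n :: int fps)"
  by (simp_all add: sgnp_def minus_one_power_iff)

lemma sum_symmetric_interval:
  fixes f :: "int \<Rightarrow> 'a::comm_monoid_add"
  shows "(\<Sum>i\<in>{- int (Suc n)..int (Suc n)}. f i) =
    (\<Sum>i\<in>{- int n..int n}. f i) + (f (int (Suc n)) + f (- int (Suc n)))"
proof -
  have "{- int (Suc n)..int (Suc n)} = insert (int (Suc n)) (insert (- int (Suc n)) {- int n..int n})"
    by auto
  then show ?thesis by (simp add: ac_simps)
qed

lemma shanks_eq:
  "shanks n = (\<Sum>i\<in>{- int n..int n}. of_int (sgnp i) * X ^ nat (pent i))"
proof (induction n)
  case 0
  show ?case by (simp add: shanks_def sgnp_def pent_def)
next
  case (Suc n)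
  show ?case
    unfolding sum_symmetric_interval shanks_Suc Suc of_int_sgnp_int nat_pent
    by (simp add: distrib_left del: power_Suc mult_Suc mult_Suc_right)
qed

text \<open>The summand \<open>s = 0\<close> is \<open>poch n\<close>; every other one carries a
  power of \<open>X\<close> with exponent at least \<open>n + 1\<close>.\<close>

lemma shanks_cong_poch: "X ^ Suc n dvd shanks n - poch n"
proof -
  have "shanks n = poch n + (\<Sum>s\<in>{1..n}. (-1) ^ s * (\<Prod>i\<in>{s<..n}. 1 - X ^ i) * X ^ (s * n + s * (s + 1) div 2))"
  proof -
    have "{..n} = insert 0 {1..n}" by auto
    moreover have "{0<..n} = {1..n}" by auto
    ultimately show ?thesis by (simp add: shanks_def poch_def)
  qed
  moreover have "X ^ Suc n dvd
    (\<Sum>s\<in>{1..n}. (-1) ^ s * (\<Prod>i\<in>{s<..n}. 1 - X ^ i) * X ^ (s * n + s * (s + 1) div 2))"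
  proof (intro dvd_sum dvd_mult le_imp_power_dvd)
    fix s assume "s \<in> {1..n}"
    then have "1 * n \<le> s * n" "1 * 2 \<le> s * (s + 1)" by (intro mult_le_mono; simp)+
    then have "n \<le> s * n" "1 \<le> s * (s + 1) div 2" by auto
    then show "Suc n \<le> s * n + s * (s + 1) div 2" by linarith
  qed
  ultimately show ?thesis by simp
qed

lemma euler_pentagonal: "euler = gseries UNIV pent sgnp"
proof (rule eq_if_cong_all_X_powers)
  fix m
  have "X ^ Suc m dvd gseries UNIV pent sgnp - shanks m"
    unfolding shanks_eq
  proof (rule gseries_cong_sum)
    fix i assume "pent i \<le> int m"
    then show "i \<in> {- int m..int m}" using pent_ge_abs[of i] by auto
  next
    fix i show "pent i \<ge> 0" using pent_ge_abs[of i] by linarith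
  qed auto
  then show "X ^ Suc m dvd euler - gseries UNIV pent sgnp"
    by (meson dvd_diff_trans dvd_diff_sym euler_cong_poch shanks_cong_poch order_refl)
qed

subsection \<open>Jacobi's identity for the cube\<close>

text \<open>Up to sign, \<open>jtp n j\<close> is the coefficient of \<open>z\<^bsup>j+1\<^esup>\<close> in
  \<open>\<Prod>\<^bsub>i\<le>n\<^esub> (1 - z q\<^bsup>i\<^esup>) \<Prod>\<^bsub>1\<le>i\<le>n\<^esub> (1 - q\<^bsup>i\<^esup>/z)\<close>. The case \<open>j = 0\<close> of the recurrence uses the antisymmetry of the
  coefficients under \<open>z\<^bsup>k\<^esup> \<leftrightarrow> z\<^bsup>1-k\<^esup>\<close>.\<close>

fun jtp :: "nat \<Rightarrow> nat \<Rightarrow> int fps" where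
  "jtp 0 j = (if j = 0 then 1 else 0)"
| "jtp (Suc n) j = (1 + X ^ (2 * Suc n)) * jtp n j
    + X ^ Suc n * ((if j = 0 then jtp n 0 else jtp n (j - 1)) + jtp n (Suc j))"

lemma jtp_eq_0: "n < j \<Longrightarrow> jtp n j = 0"
  by (induction n arbitrary: j) auto

text \<open>Formally this differentiates the finite product at \<open>z = 1\<close>, where only the
  factor \<open>1 - z\<close> needs differentiating. Antisymmetry pairs the weights
  \<open>j + 1\<close> and \<open>j\<close> into \<open>2 * j + 1\<close>. The induction reflects
  that \<open>(1 - A z) (1 - A / z)\<close> becomes \<open>(1 - A) ^ 2\<close> at
  \<open>z = 1\<close>.\<close>

lemma sum_jtp: "(\<Sum>j\<le>n. (-1) ^ j * of_nat (2 * j + 1) * jtp n j) = poch n ^ 2"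
proof (induction n)
  case 0
  show ?case by simp
next
  case (Suc n)
  define w :: "nat \<Rightarrow> int fps" where "w j = (-1) ^ j * of_nat (2 * j + 1)" for j
  define A where "A = X ^ Suc n"
  define W where "W = (\<Sum>j\<le>n. w j * jtp n j)"
  define V where "V = (\<Sum>j\<le>n. (-1) ^ j * jtp n j)"
  have z: "jtp n (Suc n) = 0" "jtp n (Suc (Suc n)) = 0" by (simp_all add: jtp_eq_0)
  have 1: "(\<Sum>j\<le>Suc n. w j * jtp n j) = W"
    by (simp add: W_def z)
  have w: "w (Suc j) = - w j - 2 * (-1) ^ j" for j
    by (simp add: w_def algebra_simps)
  \<comment> \<open>Shifting the index by one changes the weight \<open>2 * j + 1\<close> by 2,
    which produces \<open>V\<close>. The corrections in facts 2 and 3 are opposite, so the two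
    shifts together give \<open>- 2 * W\<close>.\<close>
  have 2: "(\<Sum>j\<le>Suc n. w j * (if j = 0 then jtp n 0 else jtp n (j - 1))) = jtp n 0 - W - 2 * V"
    unfolding sum.atMost_Suc_shift
    by (simp add: w W_def V_def sum_negf sum_subtractf sum_distrib_left algebra_simps sum.distrib)
      (simp add: w_def)
  have 3: "(\<Sum>j\<le>Suc n. w j * jtp n (Suc j)) = 2 * V - W - jtp n 0"
  proof -
    have "W = jtp n 0 + (\<Sum>j\<le>Suc n. w (Suc j) * jtp n (Suc j))"
    proof -
      have "W = (\<Sum>j\<le>Suc (Suc n). w j * jtp n j)" by (simp add: W_def z)
      then show ?thesis unfolding sum.atMost_Suc_shift[of _ "Suc n"] by (simp add: w_def)
    qed
    moreover have "V = jtp n 0 + (\<Sum>j\<le>Suc n. (-1) ^ Suc j * jtp n (Suc j))"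
    proof -
      have "V = (\<Sum>j\<le>Suc (Suc n). (-1) ^ j * jtp n j)" by (simp add: V_def z)
      then show ?thesis unfolding sum.atMost_Suc_shift[of _ "Suc n"] by simp
    qed
    moreover have "(\<Sum>j\<le>Suc n. w j * jtp n (Suc j)) =
      - (\<Sum>j\<le>Suc n. w (Suc j) * jtp n (Suc j)) + 2 * (\<Sum>j\<le>Suc n. (-1) ^ Suc j * jtp n (Suc j))"
      unfolding sum_distrib_left sum_negf[symmetric] sum.distrib[symmetric]
      by (intro sum.cong refl) (simp add: w algebra_simps)
    ultimately show ?thesis by (simp add: algebra_simps del: sum.atMost_Suc)
  qed
  have "(\<Sum>j\<le>Suc n. (-1) ^ j * of_nat (2 * j + 1) * jtp (Suc n) j) =
    (\<Sum>j\<le>Suc n. (1 + A * A) * (w j * jtp n j)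
      + A * (w j * (if j = 0 then jtp n 0 else jtp n (j - 1)) + w j * jtp n (Suc j)))"
  proof (rule sum.cong[OF refl])
    fix j
    have "X ^ (2 * Suc n) = A * A" unfolding A_def mult_2 power_add ..
    then show "(-1) ^ j * of_nat (2 * j + 1) * jtp (Suc n) j = (1 + A * A) * (w j * jtp n j)
      + A * (w j * (if j = 0 then jtp n 0 else jtp n (j - 1)) + w j * jtp n (Suc j))"
      unfolding jtp.simps w_def A_def[symmetric] by (simp only: algebra_simps)
  qed
  also have "\<dots> = (1 + A * A) * W + A * ((jtp n 0 - W - 2 * V) + (2 * V - W - jtp n 0))"
    unfolding sum.distrib sum_distrib_left[symmetric] 1 2 3 ..
  also have "\<dots> = W * (1 - A) ^ 2"
    by (simp add: power2_eq_square algebra_simps)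
  also have "\<dots> = poch (Suc n) ^ 2"
    using Suc.IH by (simp add: W_def w_def A_def poch_Suc power_mult_distrib del: power_Suc)
  finally show ?case .
qed

section \<open>Gaussian binomials and their limit\<close>

definition tn :: "nat \<Rightarrow> nat" where "tn j = j * (j + 1) div 2"

lemma tn_0 [simp]: "tn 0 = 0" by (simp add: tn_def)

lemma tn_Suc: "tn (Suc j) = tn j + Suc j"
proof -
  have "Suc j * (Suc j + 1) = j * (j + 1) + 2 * Suc j" by simp
  then show ?thesis by (simp add: tn_def)
qed

lemma tn_ge: "j \<le> tn j"
  by (induction j) (simp_all add: tn_Suc)

text \<open>Cleared of denominators, \<open>jtp n j\<close> is \<open>X ^ tn j\<close> times the
  Gaussian binomial of \<open>2 * n + 1\<close> over \<open>n - j\<close>. Multiplying the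
  recurrence by the common denominator \<open>L\<close> reduces the generic case to a polynomial
  identity in \<open>X\<close>, \<open>u\<close> and \<open>v\<close>.\<close>

lemma jtp_closed_form:
  "j \<le> n \<Longrightarrow> jtp n j * poch (n + j + 1) * poch (n - j) = X ^ tn j * poch (2 * n + 1)"
proof (induction n arbitrary: j)
  case 0
  then show ?case by simp
next
  case (Suc n)
  let ?S = "poch (2 * n + 1)"
  have big: "poch (2 * Suc n + 1) = ?S * (1 - X ^ (2 * n + 2)) * (1 - X ^ (2 * n + 3))"
  proof -
    have "2 * Suc n + 1 = Suc (Suc (2 * n + 1))" by simp
    then show ?thesis unfolding poch_Suc[of "Suc (2 * n + 1)"] poch_Suc[of "2 * n + 1"]
      by (simp only:) (simp add: poch_Suc numeral_3_eq_3 numeral_2_eq_2)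
  qed
  define L where "L = poch (n + j + 2) * poch (Suc n - j)"
  define v where "v = X ^ (n + j + 1)"
  have vX: "X ^ (n + j + 2) = X * v" unfolding v_def by simp
  have down: "(if j = 0 then jtp n 0 else jtp n (j - 1)) * L * X ^ Suc n =
    X ^ tn j * X ^ (Suc n - j) * ?S * (1 - v) * (1 - X * v)"
  proof (cases j)
    case 0
    have ih: "jtp n 0 * poch (n + 1) * poch n = ?S" using Suc.IH[of 0] by simp
    have "L = poch (n + 1) * poch n * (1 - v) * (1 - X * v)"
      unfolding L_def v_def 0 by (simp add: poch_Suc mult_ac)
    then have "(if j = 0 then jtp n 0 else jtp n (j - 1)) * L * X ^ Suc n =
      (jtp n 0 * poch (n + 1) * poch n) * (X ^ Suc n * (1 - v) * (1 - X * v))"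
      using 0 by (simp only: simp_thms if_True mult_ac)
    also have "\<dots> = X ^ tn j * X ^ (Suc n - j) * ?S * (1 - v) * (1 - X * v)"
      unfolding ih 0 by (simp only: tn_0 power_0 mult_1_left diff_zero mult_ac)
    finally show ?thesis .
  next
    case (Suc i)
    have ih: "jtp n i * poch (n + i + 1) * poch (n - i) = X ^ tn i * ?S"
      using Suc.IH[of i] \<open>j \<le> Suc n\<close> Suc by simp
    have "L = poch (n + i + 1) * poch (n - i) * (1 - v) * (1 - X * v)"
      unfolding L_def v_def Suc by (simp add: poch_Suc mult_ac)
    then have "(if j = 0 then jtp n 0 else jtp n (j - 1)) * L * X ^ Suc n =
      (jtp n i * poch (n + i + 1) * poch (n - i)) * (X ^ Suc n * (1 - v) * (1 - X * v))"
      using Suc by (simp only: nat.simps if_False diff_Suc_1 mult_ac)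
    also have "\<dots> = (X ^ tn i * X ^ Suc n) * ?S * (1 - v) * (1 - X * v)"
      unfolding ih by (simp only: mult_ac)
    also have "X ^ tn i * X ^ Suc n = X ^ tn j * X ^ (Suc n - j)"
      unfolding power_add[symmetric] using Suc \<open>j \<le> Suc n\<close> by (simp add: tn_Suc)
    finally show ?thesis .
  qed
  have "jtp (Suc n) j * L = X ^ tn j * poch (2 * Suc n + 1)"
  proof (cases "j = Suc n")
    case True
    have "jtp n j = 0" "jtp n (Suc j) = 0" using True by (simp_all add: jtp_eq_0)
    then have "jtp (Suc n) j * L = (if j = 0 then jtp n 0 else jtp n (j - 1)) * L * X ^ Suc n"
      unfolding jtp.simps by (simp only: mult_zero_left mult_zero_right add_0_left add_0_right mult.commute mult.left_commute)
    also have "\<dots> = X ^ tn j * poch (2 * Suc n + 1)"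
    proof -
      have "X ^ (2 * n + 2) = v" "X ^ (2 * n + 3) = X * v"
        unfolding v_def True by (simp_all add: mult_2 numeral_3_eq_3)
      then show ?thesis
        unfolding down big using True by (simp only: diff_self_eq_0 power_0 mult_1_left mult_1_right mult_ac)
    qed
    finally show ?thesis .
  next
    case False
    then have jn: "j \<le> n" using Suc.prems by simp
    define u where "u = X ^ (n - j)"
    have uX: "X ^ (Suc n - j) = X * u" unfolding u_def using jn by (simp add: Suc_diff_le)
    have L: "L = poch (n + j + 1) * poch (n - j) * (1 - X * v) * (1 - X * u)"
    proof -
      have "Suc n - j = Suc (n - j)" using jn by simp
      then show ?thesis unfolding L_def u_def v_def by (simp add: poch_Suc algebra_simps)
    qed
    have mid: "jtp n j * L = X ^ tn j * ?S * (1 - X * v) * (1 - X * u)"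
    proof -
      have "jtp n j * L =
        (jtp n j * poch (n + j + 1) * poch (n - j)) * ((1 - X * v) * (1 - X * u))"
        unfolding L by (simp only: mult_ac)
      then show ?thesis unfolding Suc.IH[OF jn] by (simp only: mult_ac)
    qed
    have up: "jtp n (Suc j) * L * X ^ Suc n = X ^ tn j * (X * v) * ?S * (1 - u) * (1 - X * u)"
    proof (cases "j = n")
      case True
      \<comment> \<open>At \<open>j = n\<close> both sides vanish: the upper neighbour is 0, and
        \<open>u = 1\<close> kills the factor \<open>1 - u\<close>.\<close>
      then show ?thesis by (simp add: jtp_eq_0 u_def)
    next
      case False
      then have "Suc j \<le> n" using jn by simp
      from Suc.IH[OF this]
      have ih: "jtp n (Suc j) * poch (n + j + 2) * poch (n - Suc j) = X ^ tn (Suc j) * ?S" by simp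
      have "n - j = Suc (n - Suc j)" using \<open>Suc j \<le> n\<close> by simp
      then have "poch (n - j) = poch (n - Suc j) * (1 - u)" unfolding u_def by (simp only: poch_Suc)
      moreover have "poch (Suc n - j) = poch (n - j) * (1 - X * u)"
        using jn by (simp add: Suc_diff_le poch_Suc u_def)
      ultimately have "L = poch (n + j + 2) * poch (n - Suc j) * (1 - u) * (1 - X * u)"
        unfolding L_def by (simp only: mult_ac)
      then have "jtp n (Suc j) * L * X ^ Suc n =
        (jtp n (Suc j) * poch (n + j + 2) * poch (n - Suc j)) * (X ^ Suc n * (1 - u) * (1 - X * u))"
        by (simp only: mult_ac)
      also have "\<dots> = (X ^ tn (Suc j) * X ^ Suc n) * ?S * (1 - u) * (1 - X * u)"
        unfolding ih by (simp only: mult_ac)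
      also have "X ^ tn (Suc j) * X ^ Suc n = X ^ tn j * (X * v)"
        unfolding vX[symmetric] power_add[symmetric] by (simp add: tn_Suc ac_simps)
      finally show ?thesis .
    qed
    have A2: "X ^ (2 * Suc n) = X * u * v" "X ^ (2 * n + 2) = X * u * v" "X ^ (2 * n + 3) = X * X * u * v"
    proof -
      have "u * v = X ^ (2 * n + 1)" unfolding u_def v_def power_add[symmetric] using jn by simp
      then show "X ^ (2 * Suc n) = X * u * v" "X ^ (2 * n + 2) = X * u * v" "X ^ (2 * n + 3) = X * X * u * v"
        by (simp_all add: mult.assoc numeral_3_eq_3)
    qed
    have "jtp (Suc n) j * L = (1 + X ^ (2 * Suc n)) * (jtp n j * L)
      + (if j = 0 then jtp n 0 else jtp n (j - 1)) * L * X ^ Suc n + jtp n (Suc j) * L * X ^ Suc n"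
      unfolding jtp.simps by (simp only: algebra_simps)
    also have "\<dots> = X ^ tn j * ?S * ((1 + X * u * v) * (1 - X * v) * (1 - X * u)
      + X * u * (1 - v) * (1 - X * v) + X * v * (1 - u) * (1 - X * u))"
      unfolding mid down up A2 uX by (simp only: distrib_left distrib_right mult_1_left mult_ac add_ac)
    also have "\<dots> = X ^ tn j * poch (2 * Suc n + 1)"
    proof -
      have "(1 + X * u * v) * (1 - X * v) * (1 - X * u) + X * u * (1 - v) * (1 - X * v)
        + X * v * (1 - u) * (1 - X * u) = (1 - X * u * v) * (1 - X * X * u * v)"
        by (simp only: ring_distribs mult_ac add_ac mult_1_left mult_1_right) (simp add: algebra_simps)
      then show ?thesis unfolding big A2 by (simp only: mult_ac)
    qed
    finally show ?thesis .
  qed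
  then show ?case unfolding L_def by (simp add: mult.assoc)
qed

text \<open>The Gaussian binomial tends to \<open>1 / euler\<close>. The index \<open>2 * m\<close>
  ensures that for \<open>j \<le> m\<close> all three \<open>poch\<close> factors agree with
  \<open>euler\<close> to the required order. For \<open>j > m\<close> both terms are divisible by
  \<open>X ^ Suc m\<close>, because \<open>tn j \<ge> j\<close>.\<close>

lemma euler_jtp_cong:
  assumes "j \<le> 2 * m"
  shows "X ^ Suc m dvd euler * jtp (2 * m) j - X ^ tn j"
proof (cases "j \<le> m")
  case True
  let ?n = "2 * m"
  have "X ^ Suc m dvd jtp ?n j * euler * euler - jtp ?n j * poch (?n + j + 1) * poch (?n - j)"
    using True by (intro dvd_diff_mult euler_cong_poch) auto
  moreover have "X ^ Suc m dvd X ^ tn j * euler - X ^ tn j * poch (2 * ?n + 1)"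
    by (intro dvd_diff_mult euler_cong_poch) auto
  ultimately have "X ^ Suc m dvd jtp ?n j * euler * euler - X ^ tn j * euler"
    unfolding jtp_closed_form[OF assms] by (meson dvd_diff_trans dvd_diff_sym)
  then have "X ^ Suc m dvd euler * (euler * jtp ?n j - X ^ tn j)"
    by (simp add: algebra_simps)
  then show ?thesis by (rule dvd_cancel_constant_1[rotated]) simp
next
  case False
  have "X ^ tn j dvd poch (2 * m + j + 1) * (poch (2 * m - j) * jtp (2 * m) j)"
  proof -
    have "poch (2 * m + j + 1) * (poch (2 * m - j) * jtp (2 * m) j) = X ^ tn j * poch (2 * (2 * m) + 1)"
      unfolding jtp_closed_form[OF assms, symmetric] by (simp only: mult_ac)
    then show ?thesis by simp
  qed
  then have "X ^ tn j dvd jtp (2 * m) j"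
    by (meson dvd_cancel_constant_1 poch_nth_0)
  moreover have "X ^ Suc m dvd X ^ tn j"
    using False tn_ge[of j] by (intro le_imp_power_dvd) simp
  ultimately have "X ^ Suc m dvd jtp (2 * m) j" by (rule dvd_trans[rotated])
  then show ?thesis using \<open>X ^ Suc m dvd X ^ tn j\<close> by (intro dvd_diff dvd_mult)
qed

lemma nat_tri:
  "nat (tri (int j + 1)) = tn j" "nat (tri (- int j)) = tn j"
proof -
  have "tri (int j + 1) = int (tn j)" "tri (- int j) = int (tn j)"
    unfolding tri_def tn_def by (simp_all add: zdiv_int algebra_simps)
  then show "nat (tri (int j + 1)) = tn j" "nat (tri (- int j)) = tn j" by simp_all
qed

lemma sum_reflected_interval:
  fixes f :: "int \<Rightarrow> 'a::comm_monoid_add"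
  shows "(\<Sum>i\<in>{- int n..int n + 1}. f i) = (\<Sum>j\<le>n. f (int j + 1) + f (- int j))"
proof (induction n)
  case 0
  have "{0..1::int} = {0, 1}" by auto
  then show ?case by (simp add: ac_simps)
next
  case (Suc n)
  have "{- int (Suc n)..int (Suc n) + 1} =
    insert (int (Suc n) + 1) (insert (- int (Suc n)) {- int n..int n + 1})" by auto
  then show ?case using Suc by (simp add: ac_simps)
qed

text \<open>The usual series with coefficients \<open>(-1) ^ j * (2 * j + 1)\<close> is unfolded
  over all integers: the indices \<open>j + 1\<close> and \<open>- j\<close> share the exponent
  \<open>tn j\<close>, and their coefficients add up to the negative of the usual one.\<close>

lemma jacobi_cube: "gseries UNIV tri (\<lambda>i. sgnp i * i) = - (euler ^ 3)"
proof (rule eq_if_cong_all_X_powers)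
  fix m :: nat
  let ?n = "2 * m"
  let ?S = "\<Sum>j\<le>?n. (-1) ^ j * of_nat (2 * j + 1) * X ^ tn j"
  have 1: "X ^ Suc m dvd gseries UNIV tri (\<lambda>i. sgnp i * i)
    - (\<Sum>i\<in>{- int ?n..int ?n + 1}. of_int (sgnp i * i) * X ^ nat (tri i))"
  proof (rule gseries_cong_sum)
    fix i assume "tri i \<le> int m"
    then show "i \<in> {- int ?n..int ?n + 1}"
      using tri_lower_bounds[of i] by auto
  qed (auto simp: tri_nonneg)
  have 2: "(\<Sum>i\<in>{- int ?n..int ?n + 1}. of_int (sgnp i * i) * X ^ nat (tri i)) = - ?S"
    unfolding sum_reflected_interval sum_negf[symmetric]
  proof (rule sum.cong[OF refl])
    fix j
    show "of_int (sgnp (int j + 1) * (int j + 1)) * X ^ nat (tri (int j + 1)) +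
      of_int (sgnp (- int j) * - int j) * X ^ nat (tri (- int j)) =
      - ((-1) ^ j * of_nat (2 * j + 1) * X ^ tn j)"
      unfolding nat_tri by (cases "even j") (simp_all add: sgnp_def algebra_simps)
  qed
  have 3: "X ^ Suc m dvd euler * poch ?n ^ 2 - ?S"
  proof -
    have "euler * poch ?n ^ 2 = (\<Sum>j\<le>?n. (-1) ^ j * of_nat (2 * j + 1) * (euler * jtp ?n j))"
      unfolding sum_jtp[symmetric] by (simp add: sum_distrib_left mult_ac)
    then show ?thesis
      by (simp only:) (intro dvd_diff_sum dvd_diff_mult euler_jtp_cong; simp)
  qed
  have 4: "X ^ Suc m dvd euler ^ 3 - euler * poch ?n ^ 2"
    unfolding power3_eq_cube power2_eq_square mult.assoc
    by (intro dvd_diff_mult euler_cong_poch) auto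
  have "X ^ Suc m dvd - ?S - - (euler ^ 3)"
    using dvd_diff_trans[OF 4 3] by simp
  then show "X ^ Suc m dvd gseries UNIV tri (\<lambda>i. sgnp i * i) - - (euler ^ 3)"
    by (rule dvd_diff_trans[OF 1[unfolded 2]])
qed

subsection \<open>The Macdonald identity of type A2\<close>

lemma sgnp_add_odd: "odd d \<Longrightarrow> sgnp (i + d) = - sgnp i"
  by (simp add: sgnp_def)

lemma tri_add: "tri (i + d) = tri i + d * i + tri d"
proof -
  have "2 * tri (i + d) = 2 * (tri i + d * i + tri d)"
    unfolding two_tri distrib_left by (simp add: algebra_simps)
  then show ?thesis by simp
qed

definition moment :: "nat \<Rightarrow> int fps" where
  "moment p = gseries UNIV tri (\<lambda>i. sgnp i * i ^ p)"

lemma moment_0: "moment 0 = 0"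
  unfolding moment_def
proof (rule gseries_eq_0_if_sign_reversing)
  show "bij_betw (\<lambda>i::int. 1 - i) UNIV UNIV"
    by (rule bij_betw_byWitness[where f' = "\<lambda>i. 1 - i"]) auto
  fix i :: int
  show "tri (1 - i) = tri i" by (simp add: tri_def algebra_simps)
  show "sgnp (1 - i) * (1 - i) ^ 0 = - (sgnp i * i ^ 0)" by (simp add: sgnp_def)
qed

text \<open>Together with \<open>moment_0\<close>, this is all that is needed of the moments: every
  product containing a higher moment also contains \<open>moment 0\<close>.\<close>

lemma moment_1: "moment 1 = - (euler ^ 3)"
  using jacobi_cube by (simp add: moment_def)

definition tri3 :: "int \<times> int \<times> int \<Rightarrow> int" where
  "tri3 z = tri (fst z) + (tri (fst (snd z)) + tri (snd (snd z)))"

lemma graded_tri3: "graded UNIV tri3"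
  using graded_times[OF graded_tri graded_times[OF graded_tri graded_tri]]
  by (simp add: tri3_def[abs_def])

lemma gseries_tri3:
  "gseries UNIV tri3 (\<lambda>z. c (fst z) * (d (fst (snd z)) * e (snd (snd z)))) =
    gseries UNIV tri c * (gseries UNIV tri d * gseries UNIV tri e)"
proof -
  have "gseries UNIV tri3 (\<lambda>z. c (fst z) * (d (fst (snd z)) * e (snd (snd z)))) =
    gseries UNIV tri c * gseries UNIV (\<lambda>z. tri (fst z) + tri (snd z)) (\<lambda>z. d (fst z) * e (snd z))"
    using gseries_times[OF graded_tri graded_times[OF graded_tri graded_tri],
      of c "\<lambda>z. d (fst z) * e (snd z)"]
    by (simp add: tri3_def[abs_def])
  then show ?thesis
    using gseries_times[OF graded_tri graded_tri, of d e] by simp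
qed

definition root_weight :: "int \<times> int \<times> int \<Rightarrow> int" where
  "root_weight = (\<lambda>(i, j, k). sgnp i * sgnp j * sgnp k * ((i - k)\<^sup>2 * (j - k)))"

text \<open>Each monomial of the weight yields a product of three moments. All monomials but
  \<open>- 2 i j k\<close> miss a variable and so contain the vanishing
  \<open>moment 0\<close>.\<close>

lemma gseries_root_weight: "gseries UNIV tri3 root_weight = 2 * euler ^ 9"
proof -
  define m where "m p q r z = (sgnp (fst z) * fst z ^ p) *
    ((sgnp (fst (snd z)) * fst (snd z) ^ q) * (sgnp (snd (snd z)) * snd (snd z) ^ r))"
    for p q r and z :: "int \<times> int \<times> int"
  have m: "gseries UNIV tri3 (m p q r) = moment p * (moment q * moment r)" for p q r
    unfolding m_def moment_def by (rule gseries_tri3)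
  have "root_weight = (\<lambda>z. m 2 1 0 z - m 2 0 1 z - m 1 1 1 z - m 1 1 1 z + m 1 0 2 z + m 1 0 2 z
    + m 0 1 2 z - m 0 0 3 z)"
    by (rule ext) (auto simp: root_weight_def m_def power2_eq_square power3_eq_cube algebra_simps)
  then have "gseries UNIV tri3 root_weight = - (2 * moment 1 ^ 3)"
    unfolding \<open>root_weight = _\<close> gseries_add gseries_diff m moment_0
    by (simp add: power3_eq_cube)
  also have "\<dots> = 2 * (euler ^ 3) ^ 3" unfolding moment_1 by (simp add: power3_eq_cube)
  finally show ?thesis by (simp flip: power_mult)
qed

text \<open>If \<open>i + j + k = 3 * u\<close>, translating all three coordinates by
  \<open>1 - 2 * u\<close> replaces \<open>u\<close> by \<open>1 - u\<close>. This involution keeps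
  the differences and \<open>tri3\<close>, while the odd translation flips all three signs.\<close>

lemma gseries_root_weight_zero: "gseries {(i, j, k). 3 dvd i + j + k} tri3 root_weight = 0"
proof (rule gseries_eq_0_if_sign_reversing)
  define d :: "int \<Rightarrow> int \<Rightarrow> int \<Rightarrow> int" where "d i j k = 1 - 2 * ((i + j + k) div 3)" for i j k
  define h where "h = (\<lambda>(i, j, k). (i + d i j k, j + d i j k, k + d i j k))"
  let ?B = "{(i, j, k). 3 dvd i + j + k} :: (int \<times> int \<times> int) set"
  have dd: "d (i + d i j k) (j + d i j k) (k + d i j k) = - d i j k" if "3 dvd i + j + k" for i j k
  proof -
    from that obtain u where u: "i + j + k = 3 * u" by blast
    have "i + (1 - 2 * u) + (j + (1 - 2 * u)) + (k + (1 - 2 * u)) = 3 * (1 - u)" using u by simp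
    then show ?thesis unfolding d_def u by simp
  qed
  have hB: "h ` ?B \<subseteq> ?B"
  proof
    fix y assume "y \<in> h ` ?B"
    then obtain i j k where y: "y = h (i, j, k)" "3 dvd i + j + k" by auto
    define e where "e = d i j k"
    have "y = (i + e, j + e, k + e)" by (simp add: y(1) h_def e_def)
    moreover have "3 dvd i + e + (j + e) + (k + e)" using y(2) by presburger
    ultimately show "y \<in> ?B" by simp
  qed
  show "bij_betw h ?B ?B"
    by (rule bij_betw_byWitness[where f' = h]) (use hB dd in \<open>auto simp: h_def\<close>)
  fix z assume "z \<in> ?B"
  then obtain i j k u where z: "z = (i, j, k)" "i + j + k = 3 * u" by (auto elim!: dvdE)
  define e where "e = 1 - 2 * u"
  have hz: "h z = (i + e, j + e, k + e)" by (simp add: h_def d_def e_def z)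
  have "3 * tri e + e * (3 * u) = 0"
  proof -
    have "2 * (3 * tri e + e * (3 * u)) = 3 * (2 * tri e) + 6 * u * e" by simp
    also have "\<dots> = 0" unfolding two_tri e_def by (simp add: algebra_simps)
    finally show ?thesis by simp
  qed
  then show "tri3 (h z) = tri3 z"
    unfolding hz z(2)[symmetric] by (simp add: tri3_def z(1) tri_add distrib_left)
  have "odd e" by (simp add: e_def)
  then show "root_weight (h z) = - root_weight z"
    unfolding hz by (simp add: root_weight_def z(1) sgnp_add_odd)
qed

section \<open>The norm form of the Eisenstein integers\<close>

definition chi3 :: "int \<Rightarrow> int" where
  "chi3 s = (if s mod 3 = 1 then 1 else if s mod 3 = 2 then -1 else 0)"

text \<open>The norm of \<open>a + b w\<close> for a primitive cube root of unity
  \<open>w\<close>.\<close>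

definition eis_norm :: "int \<times> int \<Rightarrow> int" where
  "eis_norm = (\<lambda>(a, b). a\<^sup>2 - a * b + b\<^sup>2)"

definition eis_exp :: "int \<times> int \<Rightarrow> int" where
  "eis_exp z = (eis_norm z - 1) div 3"

definition eis_weight :: "int \<times> int \<Rightarrow> int" where
  "eis_weight = (\<lambda>(a, b). - chi3 (a + b) * (a\<^sup>2 * b))"

text \<open>Not the six units of the ring, but the elements that are units modulo 3: those of norm 1
  modulo 3, on which the division in \<open>eis_exp\<close> is exact.\<close>

definition eis_units :: "(int \<times> int) set" where
  "eis_units = {(a, b). \<not> 3 dvd a + b}"

lemma eis_norm_mod_3: "eis_norm (a, b) mod 3 = (a + b)\<^sup>2 mod 3"
proof -
  have "eis_norm (a, b) = (a + b)\<^sup>2 + 3 * (- (a * b))"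
    by (simp add: eis_norm_def power2_eq_square algebra_simps)
  then show ?thesis by (simp only: mod_mult_self2)
qed

lemma eis_units_iff: "z \<in> eis_units \<longleftrightarrow> eis_norm z mod 3 = 1"
proof -
  obtain a b where z: "z = (a, b)" by fastforce
  have "\<not> 3 dvd s \<longleftrightarrow> s\<^sup>2 mod 3 = 1" for s :: int
  proof -
    have "s mod 3 = 0 \<or> s mod 3 = 1 \<or> s mod 3 = 2" by presburger
    then show ?thesis
      by (elim disjE) (simp_all add: dvd_eq_mod_eq_0 power_mod[of s 3 2, symmetric])
  qed
  then show ?thesis by (simp add: z eis_units_def eis_norm_mod_3)
qed

lemma eis_exp_eq: "z \<in> eis_units \<Longrightarrow> 3 * eis_exp z + 1 = eis_norm z"
  unfolding eis_units_iff eis_exp_def by presburger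

lemma two_eis_norm: "2 * eis_norm (a, b) = a\<^sup>2 + b\<^sup>2 + (a - b)\<^sup>2"
  by (simp add: eis_norm_def power2_eq_square algebra_simps)

lemma eis_norm_nonneg: "eis_norm z \<ge> 0"
proof -
  obtain a b where z: "z = (a, b)" by fastforce
  have "0 \<le> a\<^sup>2" "0 \<le> b\<^sup>2" "0 \<le> (a - b)\<^sup>2" by simp_all
  then show ?thesis using two_eis_norm[of a b] unfolding z by linarith
qed

lemma fibre_eis_exp: "{z \<in> eis_units. eis_exp z = int n} = {z. eis_norm z = 3 * int n + 1}"
proof (intro Collect_cong)
  fix z
  show "(z \<in> eis_units \<and> eis_exp z = int n) \<longleftrightarrow> eis_norm z = 3 * int n + 1"
    unfolding eis_units_iff eis_exp_def by presburger
qed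

lemma finite_eis_norm: "finite {z. eis_norm z = int n}"
proof (rule finite_subset)
  show "finite ({- 2 * int n..2 * int n} \<times> {- 2 * int n..2 * int n})" by simp
  show "{z. eis_norm z = int n} \<subseteq> {- 2 * int n..2 * int n} \<times> {- 2 * int n..2 * int n}"
  proof clarify
    fix a b assume "eis_norm (a, b) = int n"
    then have "a\<^sup>2 + b\<^sup>2 + (a - b)\<^sup>2 = 2 * int n" using two_eis_norm[of a b] by simp
    moreover have "\<bar>x\<bar> \<le> x\<^sup>2" for x :: int
    proof (cases "x = 0")
      case False
      then have "\<bar>x\<bar> * 1 \<le> \<bar>x\<bar> * \<bar>x\<bar>" by (intro mult_left_mono) auto
      then show ?thesis by (simp add: power2_eq_square)
    qed simp
    from this[of a] this[of b] have "\<bar>a\<bar> \<le> a\<^sup>2" "\<bar>b\<bar> \<le> b\<^sup>2" .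
    moreover have "0 \<le> a\<^sup>2" "0 \<le> b\<^sup>2" "0 \<le> (a - b)\<^sup>2" by simp_all
    ultimately have "\<bar>a\<bar> \<le> 2 * int n" "\<bar>b\<bar> \<le> 2 * int n" by linarith+
    then show "a \<in> {- 2 * int n..2 * int n} \<and> b \<in> {- 2 * int n..2 * int n}" by auto
  qed
qed

lemma graded_eis_exp: "graded eis_units eis_exp"
  unfolding graded_def
proof (intro conjI ballI allI)
  fix n
  show "finite {z \<in> eis_units. eis_exp z = int n}"
    unfolding fibre_eis_exp using finite_eis_norm[of "3 * n + 1"] by (simp add: add.commute)
next
  fix z assume "z \<in> eis_units"
  then show "0 \<le> eis_exp z" using eis_exp_eq[of z] eis_norm_nonneg[of z] by linarith
qed

text \<open>Fix the differences \<open>a = i - k\<close> and \<open>b = j - k\<close>. Then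
  \<open>tri3\<close> is quadratic in \<open>k\<close>, and a suitable integer substitution turns it
  into \<open>eis_exp (a, b) + pent l\<close>, so that the sum over \<open>l\<close> is Euler's
  series.\<close>

lemma gseries_eis_times_euler:
  "gseries eis_units eis_exp eis_weight * euler =
    gseries {(i, j, k). \<not> 3 dvd i + j + k} tri3 root_weight"
proof -
  \<comment> \<open>With \<open>s = a + b\<close> and \<open>t = s div 3\<close>, the linear
    coefficient of \<open>tri3\<close> in \<open>k\<close> is half of \<open>6 * t - 1\<close> or
    \<open>6 * t + 1\<close>, according to \<open>s mod 3\<close>. Shifting by \<open>t\<close>
    leaves half of \<open>-1\<close> or \<open>+1\<close>; reflecting \<open>l\<close> in the second
    case gives \<open>pent l\<close> both times. \<open>ll\<close> is the inverse
    substitution.\<close>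
  define kk where "kk s l = (if s mod 3 = 1 then l else - l) - s div 3" for s l :: int
  define ll where "ll s k = (if s mod 3 = 1 then k + s div 3 else - (k + s div 3))" for s k :: int
  define H where "H = (\<lambda>((a, b), l). (a + kk (a + b) l, b + kk (a + b) l, kk (a + b) l))"
  let ?A = "{(i, j, k). \<not> 3 dvd i + j + k} :: (int \<times> int \<times> int) set"
  let ?Z = "eis_units \<times> (UNIV :: int set)"
  have inv: "kk s (ll s k) = k" "ll s (kk s l) = l" for s k l
    by (auto simp: kk_def ll_def)
  have shift: "3 dvd a + k + (b + k) + k \<longleftrightarrow> 3 dvd a + b" for a b k :: int
  proof -
    have "a + k + (b + k) + k = (a + b) + 3 * k" by simp
    then show ?thesis by (simp only: dvd_add_times_triv_right_iff) presburger
  qed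
  have "bij_betw H ?Z ?A"
  proof (rule bij_betw_byWitness[where f' = "\<lambda>(i, j, k). ((i - k, j - k), ll (i - k + (j - k)) k)"])
    show "\<forall>z\<in>?Z. (\<lambda>(i, j, k). ((i - k, j - k), ll (i - k + (j - k)) k)) (H z) = z"
      by (auto simp: H_def inv)
    show "\<forall>z\<in>?A. H ((\<lambda>(i, j, k). ((i - k, j - k), ll (i - k + (j - k)) k)) z) = z"
      by (auto simp: H_def inv)
    show "H ` ?Z \<subseteq> ?A"
    proof (rule image_subsetI)
      fix z assume "z \<in> ?Z"
      then obtain a b l where "z = ((a, b), l)" "(a, b) \<in> eis_units" by auto
      then show "H z \<in> ?A"
        using shift[of a "kk (a + b) l" b] by (simp add: H_def eis_units_def)
    qed
    show "(\<lambda>(i, j, k). ((i - k, j - k), ll (i - k + (j - k)) k)) ` ?A \<subseteq> ?Z"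
    proof clarsimp
      fix i j k :: int assume "\<not> 3 dvd i + j + k"
      then show "(i - k, j - k) \<in> eis_units"
        using shift[of "i - k" k "j - k"] by (simp add: eis_units_def)
    qed
  qed
  then have "gseries ?A tri3 root_weight = gseries ?Z (\<lambda>z. tri3 (H z)) (\<lambda>z. root_weight (H z))"
    by (rule gseries_reindex)
  also have "\<dots> = gseries ?Z (\<lambda>z. eis_exp (fst z) + pent (snd z)) (\<lambda>z. eis_weight (fst z) * sgnp (snd z))"
  proof (rule gseries_cong)
    fix z assume "z \<in> ?Z"
    then obtain a b l where z: "z = ((a, b), l)" "(a, b) \<in> eis_units" by auto
    define t where "t = (a + b) div 3"
    define k where "k = kk (a + b) l"
    have Hz: "H z = (a + k, b + k, k)" by (simp add: H_def z k_def)
    have "\<not> 3 dvd a + b" using z(2) by (simp add: eis_units_def)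
    then have "(a + b) mod 3 = 1 \<or> (a + b) mod 3 = 2" by presburger
    then consider "(a + b) mod 3 = 1" | "(a + b) mod 3 = 2" by blast
    then have "tri3 (H z) = eis_exp (a, b) + pent l \<and> root_weight (H z) = eis_weight (a, b) * sgnp l"
    proof cases
      case 1
      then have b: "b = 3 * t + 1 - a" unfolding t_def by presburger
      have k: "k = l - t" using 1 by (simp add: k_def kk_def t_def)
      have "6 * tri3 (H z) = 6 * (eis_exp (a, b) + pent l)"
      proof -
        have "6 * tri3 (H z) = 3 * (2 * tri (a + k) + 2 * tri (b + k) + 2 * tri k)"
          by (simp add: Hz tri3_def)
        also have "\<dots> = 2 * (eis_norm (a, b) - 1) + 3 * (2 * pent l)"
          unfolding two_tri two_pent eis_norm_def k b
          by (simp add: algebra_simps power2_eq_square)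
        finally show ?thesis using eis_exp_eq[OF z(2)] by simp
      qed
      \<comment> \<open>The sign is the parity of \<open>a + b + 3 * k\<close>, here that of
        \<open>l + 1\<close>. In the other residue class it is that of \<open>l\<close>; this
        difference is the source of \<open>- chi3\<close>.\<close>
      moreover have "sgnp (a + k) * sgnp (b + k) * sgnp k = - sgnp l"
        unfolding b k sgnp_def by auto
      ultimately show ?thesis using 1
        by (simp add: Hz root_weight_def eis_weight_def chi3_def)
    next
      case 2
      then have b: "b = 3 * t + 2 - a" unfolding t_def by presburger
      have k: "k = - l - t" using 2 by (simp add: k_def kk_def t_def)
      have "6 * tri3 (H z) = 6 * (eis_exp (a, b) + pent l)"
      proof -
        have "6 * tri3 (H z) = 3 * (2 * tri (a + k) + 2 * tri (b + k) + 2 * tri k)"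
          by (simp add: Hz tri3_def)
        also have "\<dots> = 2 * (eis_norm (a, b) - 1) + 3 * (2 * pent l)"
          unfolding two_tri two_pent eis_norm_def k b
          by (simp add: algebra_simps power2_eq_square)
        finally show ?thesis using eis_exp_eq[OF z(2)] by simp
      qed
      moreover have "sgnp (a + k) * sgnp (b + k) * sgnp k = sgnp l"
        unfolding b k sgnp_def by auto
      ultimately show ?thesis using 2
        by (simp add: Hz root_weight_def eis_weight_def chi3_def)
    qed
    then show "tri3 (H z) = eis_exp (fst z) + pent (snd z)"
      "root_weight (H z) = eis_weight (fst z) * sgnp (snd z)"
      by (simp_all add: z(1))
  qed
  also have "\<dots> = gseries eis_units eis_exp eis_weight * euler"
    unfolding euler_pentagonal by (rule gseries_times[OF graded_eis_exp graded_pent])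
  finally show ?thesis ..
qed

text \<open>Both expansions of the triple series carry a factor \<open>euler\<close>, which cancels
  in the integral domain of power series.\<close>

lemma macdonald_A2: "2 * euler ^ 8 = gseries eis_units eis_exp eis_weight"
proof -
  let ?B = "{(i, j, k). 3 dvd i + j + k} :: (int \<times> int \<times> int) set"
  let ?A = "{(i, j, k). \<not> 3 dvd i + j + k} :: (int \<times> int \<times> int) set"
  have U: "UNIV = ?A \<union> ?B" by auto
  have "gseries UNIV tri3 root_weight = gseries ?A tri3 root_weight + gseries ?B tri3 root_weight"
    unfolding U using graded_tri3 U by (intro gseries_Un) auto
  then have "2 * euler ^ 9 = gseries eis_units eis_exp eis_weight * euler"
    unfolding gseries_root_weight gseries_root_weight_zero gseries_eis_times_euler by simp
  moreover have "2 * euler ^ 9 = (2 * euler ^ 8) * euler" by (simp flip: power_Suc2)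
  moreover have "euler \<noteq> 0" using euler_nth_0 by force
  ultimately show ?thesis by simp
qed

subsection \<open>Generating functions of partitions modulo 5\<close>

definition parts_in :: "nat set \<Rightarrow> nat \<Rightarrow> nat multiset set" where
  "parts_in S n = {M. set_mset M \<subseteq> S \<and> \<Sum>\<^sub># M = n}"

lemma finite_parts_in:
  assumes "0 \<notin> S"
  shows "finite (parts_in S n)"
proof (rule finite_subset)
  show "finite (mset ` {xs. set xs \<subseteq> {..n} \<and> length xs \<le> n})"
    by (simp add: finite_lists_length_le)
  show "parts_in S n \<subseteq> mset ` {xs. set xs \<subseteq> {..n} \<and> length xs \<le> n}"
  proof
    fix M assume M: "M \<in> parts_in S n"
    obtain xs where xs: "M = mset xs" by (metis ex_mset)
    have "is_partition M"
      using M assms unfolding parts_in_def is_partition_def by (auto intro: gr0I)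
    then have "length xs \<le> n"
      using size_le_sum_mset_partition[of M] M by (simp add: parts_in_def xs)
    moreover have "set xs \<subseteq> {..n}"
      using M member_le_sum_list[of _ xs] by (auto simp: parts_in_def xs sum_mset_sum_list)
    ultimately show "M \<in> mset ` {xs. set xs \<subseteq> {..n} \<and> length xs \<le> n}" by (auto simp: xs)
  qed
qed

text \<open>A partition either avoids \<open>k\<close> or arises by adding one copy of
  \<open>k\<close>. This is multiplication by \<open>1 - X ^ k\<close>, read
  coefficientwise.\<close>

lemma card_parts_in_insert:
  assumes "0 \<notin> S" "k \<noteq> 0" "k \<notin> S"
  shows "card (parts_in (insert k S) n) = card (parts_in S n)
    + (if k \<le> n then card (parts_in (insert k S) (n - k)) else 0)"
proof -
  let ?K = "{M \<in> parts_in (insert k S) n. k \<in># M}"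
  have split: "parts_in (insert k S) n = parts_in S n \<union> ?K"
    using assms(3) by (auto simp: parts_in_def)
  have "finite (parts_in (insert k S) n)" by (rule finite_parts_in) (use assms in auto)
  then have fin: "finite ?K" by (rule finite_subset[rotated]) auto
  have "card (parts_in (insert k S) n) = card (parts_in S n) + card ?K"
    by (subst split, rule card_Un_disjoint[OF finite_parts_in[OF assms(1)] fin])
      (use assms(3) in \<open>auto simp: parts_in_def\<close>)
  moreover have "card ?K = (if k \<le> n then card (parts_in (insert k S) (n - k)) else 0)"
  proof (cases "k \<le> n")
    case True
    have "bij_betw (\<lambda>M. M - {#k#}) ?K (parts_in (insert k S) (n - k))"
    proof (rule bij_betw_byWitness[where f' = "add_mset k"])
      show "(\<lambda>M. M - {#k#}) ` ?K \<subseteq> parts_in (insert k S) (n - k)"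
        by (auto simp: parts_in_def sum_mset.remove dest: in_diffD)
      show "add_mset k ` parts_in (insert k S) (n - k) \<subseteq> ?K"
        using True by (auto simp: parts_in_def)
    qed auto
    then show ?thesis using True by (simp add: bij_betw_same_card)
  next
    case False
    have "k \<le> n" if "M \<in> ?K" for M
      using that sum_mset.remove[of k M] by (simp add: parts_in_def)
    then have "?K = {}" using False by blast
    then show ?thesis using False by (simp only: card.empty if_False)
  qed
  ultimately show ?thesis by simp
qed

definition parts_gf :: "nat set \<Rightarrow> int fps" where
  "parts_gf S = Abs_fps (\<lambda>n. int (card (parts_in S n)))"

lemma parts_gf_insert:
  assumes "0 \<notin> S" "k \<noteq> 0" "k \<notin> S"
  shows "parts_gf (insert k S) * (1 - X ^ k) = parts_gf S"
proof (rule fps_ext)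
  fix n
  show "(parts_gf (insert k S) * (1 - X ^ k)) $ n = parts_gf S $ n"
    using card_parts_in_insert[OF assms, of n]
    by (simp add: right_diff_distrib fps_X_power_mult_right_nth parts_gf_def)
qed

lemma parts_gf_times_prod:
  assumes "finite S" "0 \<notin> S"
  shows "parts_gf S * (\<Prod>k\<in>S. 1 - X ^ k) = 1"
  using assms
proof (induction S rule: finite_induct)
  case empty
  have "parts_in {} n = (if n = 0 then {{#}} else {})" for n by (auto simp: parts_in_def)
  then show ?case by (intro fps_ext) (simp add: parts_gf_def)
next
  case (insert k S)
  have "parts_gf (insert k S) * (\<Prod>k\<in>insert k S. 1 - X ^ k) =
    parts_gf (insert k S) * (1 - X ^ k) * (\<Prod>k\<in>S. 1 - X ^ k)"
    using insert by (simp add: mult.assoc)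
  also have "\<dots> = 1"
    using insert by (subst parts_gf_insert) auto
  finally show ?case .
qed

lemma parts_gf_cong:
  assumes "\<And>k. k \<le> n \<Longrightarrow> k \<in> S \<longleftrightarrow> k \<in> S'"
  shows "X ^ Suc n dvd parts_gf S - parts_gf S'"
  unfolding X_power_dvd_iff
proof (intro allI impI)
  fix m assume "m < Suc n"
  have "set_mset M \<subseteq> S \<longleftrightarrow> set_mset M \<subseteq> S'" if "\<Sum>\<^sub># M = m" for M
    unfolding subset_eq
  proof (intro ball_cong refl assms)
    fix x assume "x \<in># M"
    from sum_mset.remove[OF this] show "x \<le> n" using that \<open>m < Suc n\<close> by simp
  qed
  then have "parts_in S m = parts_in S' m"
    unfolding parts_in_def by (intro Collect_cong) (metis (lifting))
  then show "(parts_gf S - parts_gf S') $ m = 0" by (simp add: parts_gf_def)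
qed

lemma five_dvd_fps_iff: "(5 :: int fps) dvd f \<longleftrightarrow> (\<forall>n. 5 dvd f $ n)"
proof
  assume "5 dvd f"
  then obtain g where "f = 5 * g" by (elim dvdE)
  then have "f $ n = 5 * g $ n" for n by (simp add: numeral_fps_const)
  then show "\<forall>n. 5 dvd f $ n" by simp
next
  assume *: "\<forall>n. 5 dvd f $ n"
  have "f = 5 * Abs_fps (\<lambda>n. f $ n div 5)"
    by (rule fps_ext) (use * in \<open>simp add: numeral_fps_const\<close>)
  then show "5 dvd f" by (rule dvdI)
qed

lemma dvd_diff_prod:
  fixes d :: "'a::comm_ring_1"
  assumes "\<And>x. x \<in> A \<Longrightarrow> d dvd f x - g x"
  shows "d dvd prod f A - prod g A"
  using assms by (induction A rule: infinite_finite_induct) (auto intro: dvd_diff_mult)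

text \<open>The Frobenius congruence factor by factor, with an explicit cofactor of 5.\<close>

lemma prod_multiples_of_5_cong: "5 dvd (\<Prod>i=1..m. 1 - X ^ (5 * i)) - poch m ^ 5"
  unfolding poch_def prod_power_distrib
proof (rule dvd_diff_prod)
  fix i
  define x where "x = X ^ i"
  have *: "(1 - X ^ (5 * i)) - (1 - X ^ i) ^ 5 = 5 * (x - 2 * x\<^sup>2 + 2 * x ^ 3 - x ^ 4)"
    unfolding mult.commute[of 5] power_mult x_def[symmetric]
    by (simp add: power2_eq_square power3_eq_cube eval_nat_numeral algebra_simps)
  show "5 dvd (1 - X ^ (5 * i)) - (1 - X ^ i) ^ 5" unfolding * by (rule dvd_triv_left)
qed

definition nonmult5 :: "nat set" where
  "nonmult5 = {k. \<not> 5 dvd k}"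

lemma parts_gf_nonmult5_times_euler:
  "5 dvd parts_gf nonmult5 * euler - euler ^ 5"
  unfolding five_dvd_fps_iff
proof
  fix n
  \<comment> \<open>The bound \<open>5 * n\<close> makes the complement of \<open>S\<close> in
    \<open>{1..5 * n}\<close> exactly the multiples \<open>5 * i\<close> with \<open>i\<close> in
    \<open>{1..n}\<close>, so \<open>poch (5 * n)\<close> splits exactly.\<close>
  define S where "S = nonmult5 \<inter> {1..5 * n}"
  define Q where "Q = (\<Prod>i=1..n. 1 - X ^ (5 * i))"
  have "bij_betw (\<lambda>i. 5 * i) {1..n} ({1..5 * n} - S)"
    by (rule bij_betw_byWitness[where f' = "\<lambda>i. i div 5"]) (auto simp: S_def nonmult5_def)
  from prod.reindex_bij_betw[OF this, of "\<lambda>k. 1 - X ^ k"]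
  have "poch (5 * n) = (\<Prod>k\<in>S. 1 - X ^ k) * Q"
    unfolding poch_def Q_def by (subst prod.subset_diff[of S]) (auto simp: S_def mult.commute)
  then have "parts_gf S * poch (5 * n) = (parts_gf S * (\<Prod>k\<in>S. 1 - X ^ k)) * Q"
    by (simp only: mult.assoc)
  also have "\<dots> = Q" by (subst parts_gf_times_prod) (auto simp: S_def)
  finally have S: "parts_gf S * poch (5 * n) = Q" .
  have "X ^ Suc n dvd parts_gf nonmult5 - parts_gf S"
  proof (rule parts_gf_cong)
    fix k assume "k \<le> n"
    then show "k \<in> nonmult5 \<longleftrightarrow> k \<in> S"
      by (cases "k = 0") (auto simp: S_def nonmult5_def)
  qed
  then have "X ^ Suc n dvd parts_gf nonmult5 * euler - parts_gf S * poch (5 * n)"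
    by (intro dvd_diff_mult euler_cong_poch) auto
  then have 1: "(parts_gf nonmult5 * euler) $ n = Q $ n"
    unfolding S by (simp add: X_power_dvd_iff del: power_Suc)
  have "X ^ Suc n dvd euler ^ 5 - poch n ^ 5"
    by (intro dvd_diff_power euler_cong_poch) auto
  then have 2: "(euler ^ 5) $ n = (poch n ^ 5) $ n"
    by (simp add: X_power_dvd_iff del: power_Suc)
  have "5 dvd (Q - poch n ^ 5) $ n"
    using prod_multiples_of_5_cong[of n] unfolding Q_def[symmetric] five_dvd_fps_iff by blast
  then show "5 dvd (parts_gf nonmult5 * euler - euler ^ 5) $ n"
    by (simp add: 1 2)
qed

lemma B5_gf: "Abs_fps (\<lambda>n. int (B\<^sub>5 n)) = parts_gf nonmult5 ^ 2"
proof (rule fps_ext)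
  fix n
  have reg: "regular_partition 5 M \<longleftrightarrow> set_mset M \<subseteq> nonmult5" for M
    unfolding regular_partition_def is_partition_def nonmult5_def
    by (auto intro!: gr0I)
  have "regular_bipartitions 5 n = (\<Union>i\<in>{0..n}. parts_in nonmult5 i \<times> parts_in nonmult5 (n - i))"
    by (auto simp: regular_bipartitions_def reg parts_in_def)
  moreover have fin: "finite (parts_in nonmult5 i)" for i
    by (rule finite_parts_in) (simp add: nonmult5_def)
  ultimately have "B\<^sub>5 n = (\<Sum>i=0..n. card (parts_in nonmult5 i \<times> parts_in nonmult5 (n - i)))"
    unfolding B\<^sub>5_def
    by (simp only:) (rule card_UN_disjoint, auto simp: parts_in_def)
  then show "Abs_fps (\<lambda>n. int (B\<^sub>5 n)) $ n = (parts_gf nonmult5 ^ 2) $ n"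
    by (simp add: power2_eq_square fps_mult_nth parts_gf_def card_cartesian_product)
qed

text \<open>Modulo 5, cancelling the unit \<open>euler\<close> leaves \<open>euler ^ 4\<close> for a
  single 5-regular partition; squaring accounts for the pair.\<close>

lemma B5_cong_euler: "[int (B\<^sub>5 n) = (euler ^ 8) $ n] (mod 5)"
proof -
  have "5 dvd euler * (parts_gf nonmult5 - euler ^ 4)"
    using parts_gf_nonmult5_times_euler
    by (simp add: right_diff_distrib mult.commute eval_nat_numeral)
  then have "5 dvd parts_gf nonmult5 - euler ^ 4"
    by (rule dvd_cancel_constant_1[rotated]) simp
  then have "5 dvd parts_gf nonmult5 ^ 2 - (euler ^ 4) ^ 2"
    by (rule dvd_diff_power)
  then have "5 dvd (parts_gf nonmult5 ^ 2 - (euler ^ 4) ^ 2) $ n"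
    unfolding five_dvd_fps_iff by blast
  then show ?thesis
    unfolding cong_iff_dvd_diff B5_gf[symmetric] by (simp flip: power_mult)
qed

subsection \<open>Action of an inert prime\<close>

text \<open>Otherwise neither \<open>a\<close> nor \<open>b\<close> is divisible by
  \<open>p\<close>, and \<open>a ^ 3\<close> is congruent to \<open>(- b) ^ 3\<close>. Cubing is
  injective on nonzero residues because \<open>p - 1\<close> is prime to 3, so \<open>a\<close> is
  congruent to \<open>- b\<close>. The norm is then \<open>3 * a\<^sup>2\<close> modulo
  \<open>p\<close>, which forces \<open>p\<close> to divide 3.\<close>

lemma inert_prime_dvd:
  fixes a b :: int
  assumes "prime p" "p mod 3 = 2" "int p dvd a\<^sup>2 - a * b + b\<^sup>2"
  shows "int p dvd a"
proof (rule ccontr)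
  assume na: "\<not> int p dvd a"
  have pp: "prime (int p)" using assms(1) by simp
  define m where "m = p div 3"
  have p: "p = 3 * m + 2" using assms(2) unfolding m_def by presburger
  have nb: "\<not> int p dvd b"
  proof
    assume "int p dvd b"
    moreover have "a\<^sup>2 = (a\<^sup>2 - a * b + b\<^sup>2) + b * (a - b)"
      by (simp add: power2_eq_square algebra_simps)
    ultimately have "int p dvd a\<^sup>2" using assms(3) by (metis dvd_add dvd_mult2)
    then show False using na prime_dvd_power[OF pp] by blast
  qed
  \<comment> \<open>Fermat with \<open>p - 1 = 3 * m + 1\<close>: the cube of \<open>c\<close>
    determines the inverse of \<open>c\<close>, hence \<open>c\<close> itself.\<close>
  have fermat: "[(c ^ 3) ^ m * c = 1] (mod int p)" if "\<not> int p dvd c" for c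
  proof -
    define c' where "c' = nat (c mod int p)"
    have c': "int c' = c mod int p" using prime_gt_0_nat[OF assms(1)] by (simp add: c'_def)
    have "\<not> int p dvd int c'" using that unfolding c' by (simp add: dvd_mod_iff)
    then have "\<not> p dvd c'" by simp
    then have "[c' ^ (p - 1) = 1] (mod p)" by (rule fermat_theorem[OF assms(1)])
    then have "[int (c' ^ (p - 1)) = int 1] (mod int p)" by (simp only: cong_int_iff)
    moreover have "p - 1 = 3 * m + 1" using p by simp
    ultimately have "[int c' ^ (3 * m + 1) = 1] (mod int p)" by (simp only: of_nat_power of_nat_1)
    moreover have "[c ^ (3 * m + 1) = int c' ^ (3 * m + 1)] (mod int p)"
      unfolding c' by (intro cong_pow) (simp add: cong_def)
    ultimately have "[c ^ (3 * m + 1) = 1] (mod int p)" by (rule cong_trans[rotated])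
    then show ?thesis by (simp only: power_add power_mult power_one_right)
  qed
  have cube: "[a ^ 3 = (- b) ^ 3] (mod int p)"
  proof -
    have "a ^ 3 - (- b) ^ 3 = (a\<^sup>2 - a * b + b\<^sup>2) * (a + b)"
      by (simp add: power2_eq_square power3_eq_cube algebra_simps)
    then show ?thesis using assms(3) by (simp add: cong_iff_dvd_diff)
  qed
  have eq: "[a = - b] (mod int p)"
  proof -
    have nmb: "\<not> int p dvd - b" using nb by simp
    have "[(a ^ 3) ^ m * a = ((- b) ^ 3) ^ m * (- b)] (mod int p)"
      by (rule cong_trans[OF fermat[OF na] cong_sym[OF fermat[OF nmb]]])
    moreover have "[((- b) ^ 3) ^ m * (- b) = (a ^ 3) ^ m * (- b)] (mod int p)"
      by (intro cong_mult cong_pow cong_sym[OF cube] cong_refl)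
    ultimately have "[(a ^ 3) ^ m * a = (a ^ 3) ^ m * (- b)] (mod int p)" by (rule cong_trans)
    moreover have "coprime ((a ^ 3) ^ m) (int p)"
      using prime_imp_coprime[OF pp na] by (simp add: coprime_commute)
    ultimately show ?thesis by (simp only: cong_mult_lcancel)
  qed
  have "int p dvd 3 * a\<^sup>2"
  proof -
    obtain q where "a + b = int p * q" using eq by (auto simp: cong_iff_dvd_diff)
    then have b: "b = int p * q - a" by simp
    have "3 * a\<^sup>2 = (a\<^sup>2 - a * b + b\<^sup>2) + int p * (q * (3 * a - int p * q))"
      unfolding b by (simp add: power2_eq_square algebra_simps)
    then show ?thesis using assms(3) by (simp only: dvd_add dvd_triv_left)
  qed
  moreover have "\<not> int p dvd a\<^sup>2" using na prime_dvd_power[OF pp] by blast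
  ultimately have "int p dvd int 3" using prime_dvd_multD[OF pp] by auto
  then have "p dvd 3" by (simp only: int_dvd_int_iff)
  then have "p \<le> 3" by (rule dvd_imp_le) simp
  then have "p = 2" using assms(2) by presburger
  then show False using \<open>p dvd 3\<close> by simp
qed

lemma chi3_mult_inert: "p mod 3 = 2 \<Longrightarrow> chi3 (int p * s) = - chi3 s"
proof -
  assume "p mod 3 = 2"
  then have "int p mod 3 = 2" by presburger
  then have "(int p * s) mod 3 = (2 * (s mod 3)) mod 3" by (simp add: mod_mult_eq[symmetric, of "int p" s])
  moreover have "s mod 3 = 0 \<or> s mod 3 = 1 \<or> s mod 3 = 2" by presburger
  ultimately show ?thesis unfolding chi3_def by auto
qed

text \<open>Scaling by \<open>p\<close> is a bijection from the vectors of norm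
  \<open>3 * m + 1\<close> to those of norm \<open>3 * n + 1\<close>, onto because \<open>p\<close>
  is inert. The weight gains \<open>p ^ 3\<close> from \<open>a\<^sup>2 * b\<close> and a sign from
  \<open>chi3\<close>.\<close>

lemma euler8_inert_coeff:
  assumes "prime p" "p mod 3 = 2" "3 * n + 1 = p\<^sup>2 * (3 * m + 1)"
  shows "(euler ^ 8) $ n = - (int p ^ 3) * (euler ^ 8) $ m"
proof -
  define h where "h = (\<lambda>(a, b). (int p * a, int p * b))"
  have p0: "int p \<noteq> 0" using assms(1) by auto
  have norm: "eis_norm (int p * a, int p * b) = (int p)\<^sup>2 * eis_norm (a, b)" for a b
    by (simp add: eis_norm_def power2_eq_square algebra_simps)
  have N: "3 * int n + 1 = (int p)\<^sup>2 * (3 * int m + 1)"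
    using arg_cong[OF assms(3), of int] by (simp add: algebra_simps)
  have swap: "eis_norm (b, a) = eis_norm (a, b)" for a b
    by (simp add: eis_norm_def algebra_simps)
  have coeff: "2 * (euler ^ 8) $ i = (\<Sum>z | eis_norm z = 3 * int i + 1. eis_weight z)" for i
    using arg_cong[OF macdonald_A2, of "\<lambda>f. f $ i"]
    by (simp add: gseries_nth fibre_eis_exp numeral_fps_const)
  have "bij_betw h {z. eis_norm z = 3 * int m + 1} {z. eis_norm z = 3 * int n + 1}"
    unfolding bij_betw_def
  proof
    show "inj_on h {z. eis_norm z = 3 * int m + 1}" using p0 by (auto simp: inj_on_def h_def)
    show "h ` {z. eis_norm z = 3 * int m + 1} = {z. eis_norm z = 3 * int n + 1}"
    proof
      show "h ` {z. eis_norm z = 3 * int m + 1} \<subseteq> {z. eis_norm z = 3 * int n + 1}"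
        by (auto simp: h_def norm N)
      show "{z. eis_norm z = 3 * int n + 1} \<subseteq> h ` {z. eis_norm z = 3 * int m + 1}"
      proof
        fix z assume "z \<in> {z. eis_norm z = 3 * int n + 1}"
        then obtain a b where z: "z = (a, b)" "eis_norm (a, b) = 3 * int n + 1" by (cases z) auto
        have "int p dvd eis_norm (a, b)" unfolding z(2) N power2_eq_square mult.assoc by (rule dvd_triv_left)
        \<comment> \<open>The symmetry of the form lets \<open>inert_prime_dvd\<close> apply to the
          second coordinate too.\<close>
        moreover from this have "int p dvd eis_norm (b, a)" by (simp add: swap)
        ultimately have "int p dvd a" "int p dvd b"
          unfolding eis_norm_def prod.case by (auto intro: inert_prime_dvd[OF assms(1,2)])
        then obtain a' b' where ab: "a = int p * a'" "b = int p * b'" by (auto elim!: dvdE)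
        then have "eis_norm (a', b') = 3 * int m + 1" using z(2) p0 unfolding N ab norm by simp
        then show "z \<in> h ` {z. eis_norm z = 3 * int m + 1}"
          by (intro image_eqI[of _ _ "(a', b')"]) (simp_all add: h_def z ab)
      qed
    qed
  qed
  from sum.reindex_bij_betw[OF this, of eis_weight]
  have "2 * (euler ^ 8) $ n = (\<Sum>z | eis_norm z = 3 * int m + 1. eis_weight (h z))"
    unfolding coeff by simp
  also have "\<dots> = (\<Sum>z | eis_norm z = 3 * int m + 1. - (int p ^ 3) * eis_weight z)"
  proof (rule sum.cong[OF refl])
    fix z :: "int \<times> int"
    obtain a b where z: "z = (a, b)" by fastforce
    show "eis_weight (h z) = - (int p ^ 3) * eis_weight z"
      unfolding z h_def eis_weight_def prod.case distrib_left[symmetric] chi3_mult_inert[OF assms(2)]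
      by (simp add: power2_eq_square power3_eq_cube)
  qed
  also have "\<dots> = - (int p ^ 3) * (2 * (euler ^ 8) $ m)"
    unfolding coeff sum_distrib_left ..
  finally have "2 * (euler ^ 8) $ n = 2 * (- (int p ^ 3) * (euler ^ 8) $ m)"
    by (simp only: mult.left_commute)
  then show ?thesis by (rule mult_left_cancel[THEN iffD1, rotated]) (rule zero_neq_numeral[symmetric])
qed

text \<open>With \<open>?N\<close> and \<open>?M\<close> the two arguments,
  \<open>3 * ?N + 1 = p\<^sup>2 * (3 * ?M + 1)\<close>. The coefficients of \<open>euler ^ 8\<close>
  then satisfy an exact equality; the modulus 5 enters only through
  \<open>B5_cong_euler\<close>.\<close>

theorem theorem1p12:
  fixes k p r n :: nat
  assumes "k \<ge> 1"
    and "prime p"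
    and "[p = 2] (mod 3)"
    and "p dvd 3 * r + 2"
  shows "[int (B\<^sub>5 (p ^ (k + 1) * n + p * r + (2 * p - 1) div 3))
          = (- (int p ^ 3)) * int (B\<^sub>5 (p ^ (k - 1) * n + (3 * r + 2 - p) div (3 * p)))] (mod 5)"
proof -
  let ?N = "p ^ (k + 1) * n + p * r + (2 * p - 1) div 3"
  let ?M = "p ^ (k - 1) * n + (3 * r + 2 - p) div (3 * p)"
  have p3: "p mod 3 = 2" using assms(3) by (simp add: cong_def)
  have p0: "p > 0" using assms(2) by (rule prime_gt_0_nat)
  have e1: "3 * ((2 * p - 1) div 3) = 2 * p - 1" using p3 by presburger
  obtain m where m: "3 * r + 2 = p * m" using assms(4) by (elim dvdE)
  \<comment> \<open>Modulo 3 the equation \<open>3 * r + 2 = p * m\<close> reads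
    \<open>2 = 2 * m\<close>. Hence \<open>m = 3 * i + 1\<close>, and \<open>i\<close> is the offset
    in \<open>?M\<close>.\<close>
  have "m mod 3 = 1"
  proof -
    have "(p * m) mod 3 = 2" unfolding m[symmetric] by presburger
    then have "(2 * m) mod 3 = 2" using mod_mult_left_eq[of p 3 m] by (simp only: p3)
    then show ?thesis by presburger
  qed
  then obtain i where i: "m = 3 * i + 1" by (metis mult_div_mod_eq)
  have "3 * r + 2 - p = 3 * p * i" using m i by (simp add: algebra_simps)
  then have e2: "(3 * r + 2 - p) div (3 * p) = i" using p0 by simp
  obtain l where k: "k = Suc l" using assms(1) by (cases k) auto
  have "3 * ?N + 1 = 3 * p ^ (k + 1) * n + p * (3 * r + 2)"
    using e1 p0 by (simp add: algebra_simps)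
  also have "\<dots> = p\<^sup>2 * (3 * ?M + 1)"
    unfolding m e2 i k by (simp add: power2_eq_square algebra_simps)
  finally have eq: "(euler ^ 8) $ ?N = - (int p ^ 3) * (euler ^ 8) $ ?M"
    by (rule euler8_inert_coeff[OF assms(2) p3])
  have "[- (int p ^ 3) * (euler ^ 8) $ ?M = - (int p ^ 3) * int (B\<^sub>5 ?M)] (mod 5)"
    by (intro cong_mult cong_refl cong_sym[OF B5_cong_euler])
  with B5_cong_euler[of ?N] show ?thesis unfolding eq by (rule cong_trans)
qed

end
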